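(* For every compact median pretree $X$ and its automorphism group $G=H_+(X)$, the action of the topological group $G$ on $X$ is Rosenthal representable. It follows that the topological group $H_+(X)$ is Rosenthal representable.
   Context: A pretree is a pair $(X,R)$ with $X$ a set and $R$ a ternary relation on $X$ (write $\langle a,b,c\rangle$ for $(a,b,c)\in R$) such that: (B1) $\langle a,b,c\rangle\Rightarrow\langle c,b,a\rangle$; (B2) $\langle a,b,c\rangle\wedge\langle a,c,b\rangle\Leftrightarrow b=c$; (B3) $\langle a,b,c\rangle\Rightarrow\langle a,b,d\rangle\vee\langle d,b,c\rangle$. Put $[u,v]=\{x\in X:\langle u,x,v\rangle\}$. The pretree is a median pretree if $[a,b]\cap[a,c]\cap[b,c]\neq\emptyset$ for all $a,b,c\in X$ (then this set is a singleton, denoted $m(a,b,c)$, the median). The shadow topology $\tau_s$ on a pretree $X$ has as a subbase of closed sets the family of all $S^v_u=\{x\in X:u\in[x,v]\}$, $u,v\in X$, $u\ne v$. The shadow topology of a median pretree is Hausdorff. A compact median pretree is a median pretree whose shadow topology is compact; it is considered as a topological space with this topology. $H(X)$ is the group of all homeomorphisms of $X$ with the compact-open topology. $H_+(X)$ is the topological subgroup of $H(X)$ consisting of the $R$-monotone homeomorphisms, i.e. those $g$ for which $\langle a,b,c\rangle$ implies $\langle ga,gb,gc\rangle$ (equivalently, median-preserving homeomorphisms). For a Banach space $V$, $Is(V)$ is the topological group of all linear isometries of $V$ onto $V$ with the strong operator topology. $V$ is a Rosenthal Banach space if it contains no isomorphic copy of $\ell_1$. A representation of an action $G\curvearrowright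 X$ on $V$ is a pair $(h,\alpha)$ where $h:G\to Is(V)$ is a strongly continuous co-homomorphism ($h(g_1g_2)=h(g_2)h(g_1)$), and $\alpha:X\to V^*$ is a weak-star continuous bounded map with $\langle v,\alpha(gx)\rangle=\langle h(g)(v),\alpha(x)\rangle$ for all $v\in V$, $g\in G$, $x\in X$. The action is Rosenthal representable if there are a Rosenthal Banach space $V$ and a representation $(h,\alpha)$ on $V$ with $\alpha$ a topological embedding (for the weak-star topology). A topological group $G$ is Rosenthal representable if it is topologically isomorphic to a topological subgroup of $Is(V)$ for some Rosenthal Banach space $V$. *)

theory Defs
  imports
    "HOL-Analysis.Analysis"
    "HOL-Algebra.Group_Action"
    "HOL-Library.Function_Algebras"
begin

(* Conventions.  Pretrees, groups and Banach spaces live on explicit carrier sets.  Maps out of a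
   carrier are extensional (undefined outside it), so that they are genuine maps of carriers.
   Banach spaces are real. *)

section \<open>Pretrees\<close>

locale pretree =
  fixes X :: "'a set" and R :: "('a \<times> 'a \<times> 'a) set"
  assumes R_subset: "R \<subseteq> X \<times> X \<times> X"
    and B1: "\<lbrakk>a \<in> X; b \<in> X; c \<in> X; (a, b, c) \<in> R\<rbrakk> \<Longrightarrow> (c, b, a) \<in> R"
    and B2: "\<lbrakk>a \<in> X; b \<in> X; c \<in> X\<rbrakk> \<Longrightarrow> (a, b, c) \<in> R \<and> (a, c, b) \<in> R \<longleftrightarrow> b = c"
    and B3: "\<lbrakk>a \<in> X; b \<in> X; c \<in> X; d \<in> X; (a, b, c) \<in> R\<rbrakk>
              \<Longrightarrow> (a, b, d) \<in> R \<or> (d, b, c) \<in> R"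

definition pt_interval :: "'a set \<Rightarrow> ('a \<times> 'a \<times> 'a) set \<Rightarrow> 'a \<Rightarrow> 'a \<Rightarrow> 'a set"
  where "pt_interval X R u v = {x \<in> X. (u, x, v) \<in> R}"

locale median_pretree = pretree +
  assumes median: "\<lbrakk>a \<in> X; b \<in> X; c \<in> X\<rbrakk>
    \<Longrightarrow> pt_interval X R a b \<inter> pt_interval X R a c \<inter> pt_interval X R b c \<noteq> {}"

definition shadow :: "'a set \<Rightarrow> ('a \<times> 'a \<times> 'a) set \<Rightarrow> 'a \<Rightarrow> 'a \<Rightarrow> 'a set"
  where "shadow X R u v = {x \<in> X. u \<in> pt_interval X R x v}"

(* X itself is listed (it is the empty intersection of subbasic open sets) because
   topology_generated_by takes the union of the given family as underlying set. *)
definition shadow_topology :: "'a set \<Rightarrow> ('a \<times> 'a \<times> 'a) set \<Rightarrow> 'a topology"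
  where "shadow_topology X R =
    topology_generated_by (insert X {X - shadow X R u v |u v. u \<in> X \<and> v \<in> X \<and> u \<noteq> v})"

locale compact_median_pretree = median_pretree +
  assumes compact: "compact_space (shadow_topology X R)"


section \<open>Topological groups and homeomorphism groups\<close>

definition topological_group :: "('g, 'm) monoid_scheme \<Rightarrow> 'g topology \<Rightarrow> bool"
  where "topological_group G T \<longleftrightarrow>
    group G \<and> topspace T = carrier G \<and>
    continuous_map (prod_topology T T) T (\<lambda>(g, h). g \<otimes>\<^bsub>G\<^esub> h) \<and>
    continuous_map T T (\<lambda>g. inv\<^bsub>G\<^esub> g)"

definition homeos :: "'a topology \<Rightarrow> ('a \<Rightarrow> 'a) set"
  where "homeos S = {f \<in> extensional (topspace S). homeomorphic_map S S f}"

definition homeo_group :: "'a topology \<Rightarrow> ('a \<Rightarrow> 'a) monoid"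
  where "homeo_group S = (BijGroup (topspace S))\<lparr>carrier := homeos S\<rparr>"

definition compact_open_topology :: "'a topology \<Rightarrow> ('a \<Rightarrow> 'a) topology"
  where "compact_open_topology S =
    topology_generated_by {{f \<in> homeos S. f ` K \<subseteq> U} |K U. compactin S K \<and> openin S U}"

definition monotone_homeos :: "'a set \<Rightarrow> ('a \<times> 'a \<times> 'a) set \<Rightarrow> ('a \<Rightarrow> 'a) set"
  where "monotone_homeos X R =
    {g \<in> homeos (shadow_topology X R). \<forall>a b c. (a, b, c) \<in> R \<longrightarrow> (g a, g b, g c) \<in> R}"

definition H_plus :: "'a set \<Rightarrow> ('a \<times> 'a \<times> 'a) set \<Rightarrow> ('a \<Rightarrow> 'a) monoid"
  where "H_plus X R = (homeo_group (shadow_topology X R))\<lparr>carrier := monotone_homeos X R\<rparr>"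

definition H_plus_topology :: "'a set \<Rightarrow> ('a \<times> 'a \<times> 'a) set \<Rightarrow> ('a \<Rightarrow> 'a) topology"
  where "H_plus_topology X R =
    subtopology (compact_open_topology (shadow_topology X R)) (monotone_homeos X R)"

definition continuous_action ::
    "('g, 'm) monoid_scheme \<Rightarrow> 'g topology \<Rightarrow> 'a topology \<Rightarrow> ('g \<Rightarrow> 'a \<Rightarrow> 'a) \<Rightarrow> bool"
  where "continuous_action G T S act \<longleftrightarrow>
    topological_group G T \<and> group_action G (topspace S) act \<and>
    continuous_map (prod_topology T S) S (\<lambda>(g, x). act g x)"


section \<open>Rosenthal Banach spaces\<close>

(* Pointwise real vector space structure on functions; addition comes from Function_Algebras. *)
instantiation "fun" :: (type, real_vector) real_vector
begin

definition scaleR_fun :: "real \<Rightarrow> ('a \<Rightarrow> 'b) \<Rightarrow> 'a \<Rightarrow> 'b"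
  where "scaleR_fun c f = (\<lambda>x. c *\<^sub>R f x)"

instance
  by standard (auto simp: scaleR_fun_def fun_eq_iff scaleR_add_right scaleR_add_left)

end

(* A Banach space is given by a linear subspace V of an ambient vector space without any topology,
   and a complete norm N, which matters only on V. *)
locale banach_on =
  fixes V :: "'v::real_vector set" and N :: "'v \<Rightarrow> real"
  assumes subspace: "subspace V"
    and norm_eq_0: "x \<in> V \<Longrightarrow> N x = 0 \<longleftrightarrow> x = 0"
    and norm_triangle: "\<lbrakk>x \<in> V; y \<in> V\<rbrakk> \<Longrightarrow> N (x + y) \<le> N x + N y"
    and norm_scaleR: "x \<in> V \<Longrightarrow> N (c *\<^sub>R x) = \<bar>c\<bar> * N x"
    and complete: "Metric_space.mcomplete V (\<lambda>x y. N (x - y))"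

definition norm_topology :: "'v::real_vector set \<Rightarrow> ('v \<Rightarrow> real) \<Rightarrow> 'v topology"
  where "norm_topology V N = Metric_space.mtopology V (\<lambda>x y. N (x - y))"

definition linear_map_on :: "'v::real_vector set \<Rightarrow> ('v \<Rightarrow> 'w::real_vector) \<Rightarrow> bool"
  where "linear_map_on V f \<longleftrightarrow>
    (\<forall>x\<in>V. \<forall>y\<in>V. f (x + y) = f x + f y) \<and> (\<forall>c. \<forall>x\<in>V. f (c *\<^sub>R x) = c *\<^sub>R f x)"

definition l1_space :: "(nat \<Rightarrow> real) set"
  where "l1_space = {x. summable (\<lambda>n. \<bar>x n\<bar>)}"

definition l1_norm :: "(nat \<Rightarrow> real) \<Rightarrow> real"
  where "l1_norm x = (\<Sum>n. \<bar>x n\<bar>)"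

definition contains_l1 :: "'v::real_vector set \<Rightarrow> ('v \<Rightarrow> real) \<Rightarrow> bool"
  where "contains_l1 V N \<longleftrightarrow>
    (\<exists>J c C. J \<in> l1_space \<rightarrow> V \<and> linear_map_on l1_space J \<and> 0 < c \<and>
       (\<forall>x\<in>l1_space. c * l1_norm x \<le> N (J x) \<and> N (J x) \<le> C * l1_norm x))"

definition rosenthal_space :: "'v::real_vector set \<Rightarrow> ('v \<Rightarrow> real) \<Rightarrow> bool"
  where "rosenthal_space V N \<longleftrightarrow> banach_on V N \<and> \<not> contains_l1 V N"

definition isometries :: "'v::real_vector set \<Rightarrow> ('v \<Rightarrow> real) \<Rightarrow> ('v \<Rightarrow> 'v) set"
  where "isometries V N =
    {f \<in> extensional V. bij_betw f V V \<and> linear_map_on V f \<and> (\<forall>x\<in>V. N (f x) = N x)}"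

definition Is :: "'v::real_vector set \<Rightarrow> ('v \<Rightarrow> real) \<Rightarrow> ('v \<Rightarrow> 'v) monoid"
  where "Is V N = (BijGroup V)\<lparr>carrier := isometries V N\<rparr>"

(* Strong operator topology: pointwise convergence in norm. *)
definition sot :: "'v::real_vector set \<Rightarrow> ('v \<Rightarrow> real) \<Rightarrow> ('v \<Rightarrow> 'v) topology"
  where "sot V N = subtopology (product_topology (\<lambda>_. norm_topology V N) V) (isometries V N)"

definition dual_space :: "'v::real_vector set \<Rightarrow> ('v \<Rightarrow> real) \<Rightarrow> ('v \<Rightarrow> real) set"
  where "dual_space V N =
    {f \<in> extensional V. linear_map_on V f \<and> (\<exists>B. \<forall>v\<in>V. \<bar>f v\<bar> \<le> B * N v)}"

definition weak_star :: "'v::real_vector set \<Rightarrow> ('v \<Rightarrow> real) \<Rightarrow> ('v \<Rightarrow> real) topology"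
  where "weak_star V N = subtopology (product_topology (\<lambda>_. euclideanreal) V) (dual_space V N)"


section \<open>Representations\<close>

(* The fourth conjunct says that alpha is bounded in the dual norm. *)
definition representation ::
    "('g, 'm) monoid_scheme \<Rightarrow> 'g topology \<Rightarrow> 'a topology \<Rightarrow> ('g \<Rightarrow> 'a \<Rightarrow> 'a) \<Rightarrow>
     'v::real_vector set \<Rightarrow> ('v \<Rightarrow> real) \<Rightarrow> ('g \<Rightarrow> 'v \<Rightarrow> 'v) \<Rightarrow> ('a \<Rightarrow> 'v \<Rightarrow> real) \<Rightarrow> bool"
  where "representation G T S act V N h \<alpha> \<longleftrightarrow>
    continuous_map T (sot V N) h \<and>
    (\<forall>g\<^sub>1\<in>carrier G. \<forall>g\<^sub>2\<in>carrier G. h (g\<^sub>1 \<otimes>\<^bsub>G\<^esub> g\<^sub>2) = h g\<^sub>2 \<otimes>\<^bsub>Is V N\<^esub> h g\<^sub>1) \<and>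
    continuous_map S (weak_star V N) \<alpha> \<and>
    (\<exists>B. \<forall>x\<in>topspace S. \<forall>v\<in>V. \<bar>\<alpha> x v\<bar> \<le> B * N v) \<and>
    (\<forall>v\<in>V. \<forall>g\<in>carrier G. \<forall>x\<in>topspace S. \<alpha> (act g x) v = \<alpha> x (h g v))"

(* HOL cannot quantify over types inside a formula, so the type of the vectors is a parameter of
   the following two notions.  Being representable relative to some type 'v gives representability
   in the unrestricted sense. *)
definition rosenthal_representable_action ::
    "'v::real_vector itself \<Rightarrow> ('g, 'm) monoid_scheme \<Rightarrow> 'g topology \<Rightarrow> 'a topology \<Rightarrow>
     ('g \<Rightarrow> 'a \<Rightarrow> 'a) \<Rightarrow> bool"
  where "rosenthal_representable_action _ G T S act \<longleftrightarrow>
    continuous_action G T S act \<and>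
    (\<exists>(V :: 'v set) N h \<alpha>. rosenthal_space V N \<and> representation G T S act V N h \<alpha> \<and>
       embedding_map S (weak_star V N) \<alpha>)"

definition rosenthal_representable_group ::
    "'v::real_vector itself \<Rightarrow> ('g, 'm) monoid_scheme \<Rightarrow> 'g topology \<Rightarrow> bool"
  where "rosenthal_representable_group _ G T \<longleftrightarrow>
    topological_group G T \<and>
    (\<exists>(V :: 'v set) N K \<phi>. rosenthal_space V N \<and> subgroup K (Is V N) \<and>
       \<phi> \<in> iso G ((Is V N)\<lparr>carrier := K\<rparr>) \<and>
       homeomorphic_map T (subtopology (sot V N) K) \<phi>)"

end

(* A halfspace is a convex set with convex complement; axiom (B3) and medians make the halfspaces of X a
   nested family.  Call a finite family of pairs of points admissible if every halfspace separates at
   most one of the pairs.  A function with values in [0,1] whose superlevel sets are halfspaces has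
   variation at most 1 along each admissible family, and the continuous functions of this kind separate
   the points of X.  The representation space is the closure of the continuous functions of bounded
   variation in the sup norm plus the quadratic variation over admissible families.  Precomposition with
   an automorphism permutes the admissible families, so it is an isometry; it is strongly continuous
   because the quadratic variation of f is at most 2 sup|f| Var(f).

   No sequence in this space is equivalent to the unit basis of l1.  If n functions have bounded quadratic
   variation and a finite set of points is e-separated by them, then pairing off its points admissibly
   bounds its size linearly in n, so suitable signs give signed averages that are uniformly small.  Blocks
   of this kind, perturbed to have bounded variation and chosen so that each is uniformly small compared
   with the variation of the sum of its predecessors, satisfy an upper 2-estimate, which contradicts a
   lower l1-estimate. *)

theory Submission
  imports Defs
begin

section \<open>Halfspaces of pretrees\<close>

text \<open>The norm has to avoid two extremes. If \<open>X\<close> is an interval, closing up in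
  the sup norm alone gives all continuous functions, and the variation norm admits all primitives of
  integrable functions; both spaces contain l1. Quadratic variation lies in between. The model of an
  l1-sequence is the Rademacher sequence: n of its members realise all 2^n sign patterns and need
  exponentially many distinguishable points. Here n functions of bounded norm distinguish only
  linearly many points, so a Hoeffding estimate with a union bound finds signs that are good
  everywhere at once. This alone refutes nothing, since an average of small sup norm may keep a
  quadratic variation of order 1. Adding n such averages does: almost without cross terms the norm
  grows like sqrt n, where l1 would demand growth like n. Cross terms are controlled against
  functions of finite variation only, hence the closure of those. The separating functions come from
  the order on [u,v]: if it is dense, Urysohn's construction applies; if it has a jump, the jump
  cuts \<open>X\<close> into two clopen halfspaces.\<close>

definition pt_convex :: "'a set \<Rightarrow> ('a \<times> 'a \<times> 'a) set \<Rightarrow> 'a set \<Rightarrow> bool"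
  where "pt_convex X R C \<longleftrightarrow> C \<subseteq> X \<and> (\<forall>a\<in>C. \<forall>b\<in>C. pt_interval X R a b \<subseteq> C)"

definition halfspaces :: "'a set \<Rightarrow> ('a \<times> 'a \<times> 'a) set \<Rightarrow> 'a set set"
  where "halfspaces X R = {H. pt_convex X R H \<and> pt_convex X R (X - H)}"

lemma halfspace_subset: "H \<in> halfspaces X R \<Longrightarrow> H \<subseteq> X"
  by (simp add: halfspaces_def pt_convex_def)

lemma halfspace_compl: "H \<in> halfspaces X R \<Longrightarrow> X - H \<in> halfspaces X R"
  by (auto simp add: halfspaces_def pt_convex_def double_diff)

section \<open>Calculus of betweenness from (B1), (B2) and (B3)\<close>

context pretree
begin

lemma R_in: "(a, b, c) \<in> R \<Longrightarrow> a \<in> X \<and> b \<in> X \<and> c \<in> X"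
  using R_subset by blast

lemma R_sym: "(a, b, c) \<in> R \<Longrightarrow> (c, b, a) \<in> R"
  using B1 R_in by blast

lemma R_cut: "\<lbrakk>(a, b, c) \<in> R; d \<in> X\<rbrakk> \<Longrightarrow> (a, b, d) \<in> R \<or> (d, b, c) \<in> R"
  using B3 R_in by blast

lemma R_antisym: "\<lbrakk>(a, b, c) \<in> R; (a, c, b) \<in> R\<rbrakk> \<Longrightarrow> b = c"
  using B2 R_in by blast

lemma R_refl: "\<lbrakk>a \<in> X; b \<in> X\<rbrakk> \<Longrightarrow> (a, b, b) \<in> R" "\<lbrakk>a \<in> X; b \<in> X\<rbrakk> \<Longrightarrow> (a, a, b) \<in> R"
  using B2 R_sym by blast+

lemma R_degenerate: "(a, b, a) \<in> R \<Longrightarrow> b = a"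
  using R_antisym[of a b a] R_refl(2)[of a b] R_in[of a b a] by blast

text \<open>Cutting \<open>(u, y, z)\<close> at \<open>x\<close> leaves \<open>(u, y, x)\<close> as
  the only alternative, and that one collapses to \<open>x = y\<close>.\<close>

lemma R_inner: "\<lbrakk>(u, x, y) \<in> R; (u, y, z) \<in> R\<rbrakk> \<Longrightarrow> (x, y, z) \<in> R"
  using R_cut[of u y z x] R_antisym[of u x y] R_refl(2)[of y z] R_in[of u x y] R_in[of u y z] by blast

lemma R_trans: "\<lbrakk>(u, x, y) \<in> R; (u, y, z) \<in> R\<rbrakk> \<Longrightarrow> (u, x, z) \<in> R"
  using R_inner[of u x y z] R_cut[of u x y z] R_antisym[of z x y] R_sym[of x y z] R_in[of u y z]
  by blast

lemma space_halfspace: "X \<in> halfspaces X R"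
  by (auto simp add: halfspaces_def pt_convex_def pt_interval_def)

lemma shadow_halfspace:
  assumes "u \<in> X" "v \<in> X"
  shows "shadow X R u v \<in> halfspaces X R"
proof -
  \<comment> \<open>Convexity of the shadow: \<open>z\<close> lies between \<open>u\<close> and one
    of \<open>x\<close>, \<open>y\<close>; cutting at \<open>z\<close> the triple that puts
    \<open>u\<close> between this point and \<open>v\<close> leaves the claim or
    \<open>z = u\<close>.\<close>
  have 1: "(z, u, v) \<in> R" if "(x, u, v) \<in> R" "(y, u, v) \<in> R" "(x, z, y) \<in> R" for x y z
  proof -
    from that(3) have "(x, z, u) \<in> R \<or> (u, z, y) \<in> R" using R_cut assms by blast
    then have "z = u \<or> (z, u, v) \<in> R"
    proof
      assume "(x, z, u) \<in> R"
      then show ?thesis using R_cut[OF that(1), of z] R_antisym[of x z u] R_in by blast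
    next
      assume "(u, z, y) \<in> R"
      then have "(y, z, u) \<in> R" using R_sym by blast
      then show ?thesis using R_cut[OF that(2), of z] R_antisym[of y z u] R_in by blast
    qed
    then show ?thesis using R_refl(2) assms by blast
  qed
  \<comment> \<open>Convexity of the complement, contrapositively: if neither end lies in the
    shadow, then \<open>u\<close> is between \<open>z\<close> and each of them, which forces
    \<open>z = u\<close>, and cutting at \<open>v\<close> gives a contradiction.\<close>
  have 2: "(x, u, v) \<in> R \<or> (y, u, v) \<in> R" if "(z, u, v) \<in> R" "(x, z, y) \<in> R" for x y z
  proof (rule ccontr)
    assume not: "\<not> ?thesis"
    have xy: "x \<in> X" "y \<in> X" using that R_in by blast+
    then have "(z, u, x) \<in> R" "(z, u, y) \<in> R"
      using R_cut[OF that(1)] not by blast+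
    then have "(u, z, y) \<notin> R \<or> z = u" "(x, z, u) \<notin> R \<or> z = u"
      using R_antisym[of y z u] R_antisym[of x z u] R_sym by blast+
    then have "z = u" using R_cut[OF that(2) assms(1)] by blast
    then show False using R_cut[OF that(2) assms(2)] not R_sym by blast
  qed
  show ?thesis
    using assms unfolding halfspaces_def pt_convex_def shadow_def pt_interval_def
    by (auto dest: 1 2)
qed

end

text \<open>A point \<open>d\<close> in the fourth corner is impossible: the median of
  \<open>a\<close>, \<open>b\<close>, \<open>c\<close> lies in \<open>H \<inter> T\<close>, but (B3)
  puts it between \<open>b\<close> and \<open>d\<close>, which both miss \<open>H\<close>, or
  between \<open>d\<close> and \<open>c\<close>, which both miss \<open>T\<close>.\<close>

lemma (in median_pretree) halfspaces_nested:
  assumes H: "H \<in> halfspaces X R" and T: "T \<in> halfspaces X R"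
    and a: "a \<in> H \<inter> T" and b: "b \<in> T - H" and c: "c \<in> H - T"
  shows "X - (H \<union> T) = {}"
proof (rule ccontr)
  assume "X - (H \<union> T) \<noteq> {}"
  then obtain d where d: "d \<in> X" "d \<notin> H" "d \<notin> T" by blast
  have X: "a \<in> X" "b \<in> X" "c \<in> X" using a b c halfspace_subset[OF H] halfspace_subset[OF T] by auto
  obtain m where m: "m \<in> pt_interval X R a b" "m \<in> pt_interval X R a c" "m \<in> pt_interval X R b c"
    using median[OF X] by blast
  have cH: "x \<in> H" if "y \<in> H" "z \<in> H" "x \<in> pt_interval X R y z" for x y z
    using H that unfolding halfspaces_def pt_convex_def by blast
  have cH': "x \<in> X - H" if "y \<in> X - H" "z \<in> X - H" "x \<in> pt_interval X R y z" for x y z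
    using H that unfolding halfspaces_def pt_convex_def by blast
  have cT: "x \<in> T" if "y \<in> T" "z \<in> T" "x \<in> pt_interval X R y z" for x y z
    using T that unfolding halfspaces_def pt_convex_def by blast
  have cT': "x \<in> X - T" if "y \<in> X - T" "z \<in> X - T" "x \<in> pt_interval X R y z" for x y z
    using T that unfolding halfspaces_def pt_convex_def by blast
  have mT: "m \<in> T" using cT a b m by blast
  have mH: "m \<in> H" using cH a c m by blast
  have mX: "m \<in> X" using m unfolding pt_interval_def by blast
  from m(3) d have "(b, m, d) \<in> R \<or> (d, m, c) \<in> R"
    using R_cut[of b m c d] by (auto simp: pt_interval_def)
  then show False
    using cH'[of b d m] cT'[of d c m] mT mH mX d b c X unfolding pt_interval_def by auto
qed

text \<open>Monotonicity is demanded in the forward direction only; this makes inverses monotone.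
  The image of the median of \<open>a\<close>, \<open>b\<close>, \<open>c\<close> lies between
  \<open>g b\<close> and each of \<open>g a\<close>, \<open>g c\<close>, so if \<open>g b\<close> is
  between those two, the median is \<open>b\<close>.\<close>

lemma (in median_pretree) monotone_imp_reflecting:
  assumes g: "bij_betw g X X" and mono: "\<And>a b c. (a, b, c) \<in> R \<Longrightarrow> (g a, g b, g c) \<in> R"
    and X: "a \<in> X" "b \<in> X" "c \<in> X" and R: "(g a, g b, g c) \<in> R"
  shows "(a, b, c) \<in> R"
proof -
  obtain m where m: "(a, m, b) \<in> R" "(a, m, c) \<in> R" "(b, m, c) \<in> R" "m \<in> X"
    using median[OF X] unfolding pt_interval_def by blast
  have "(g a, g m, g b) \<in> R" "(g b, g m, g c) \<in> R"
    using mono m by blast+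
  then have "g m = g b"
    using R R_inner[of "g a" "g m" "g b" "g c"] R_sym R_antisym[of "g c" "g m" "g b"] by blast
  then have "m = b"
    using g m(4) X(2) unfolding bij_betw_def inj_on_def by blast
  then show ?thesis using m by blast
qed

section \<open>Continuous monotone functions separate the points of a median pretree\<close>

lemma topspace_shadow_topology [simp]: "topspace (shadow_topology X R) = X"
  by (auto simp: shadow_topology_def)

lemma openin_shadow_compl:
  "\<lbrakk>u \<in> X; v \<in> X; u \<noteq> v\<rbrakk> \<Longrightarrow> openin (shadow_topology X R) (X - shadow X R u v)"
  unfolding shadow_topology_def by (rule topology_generated_by_Basis) blast

lemma halfspaces_UN_chain:
  assumes A: "\<And>i. i \<in> I \<Longrightarrow> A i \<in> halfspaces X R"
    and chain: "\<And>i j. \<lbrakk>i \<in> I; j \<in> I\<rbrakk> \<Longrightarrow> A i \<subseteq> A j \<or> A j \<subseteq> A i"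
  shows "(\<Union>i\<in>I. A i) \<in> halfspaces X R"
proof -
  have 1: "A i \<subseteq> X" if "i \<in> I" for i
    using A[OF that] halfspace_subset by blast
  have 2: "pt_interval X R a b \<subseteq> A i" if "i \<in> I" "a \<in> A i" "b \<in> A i" for i a b
    using A[OF that(1)] that unfolding halfspaces_def pt_convex_def by blast
  have 3: "pt_interval X R a b \<subseteq> X - A i" if "i \<in> I" "a \<in> X - A i" "b \<in> X - A i" for i a b
    using A[OF that(1)] that unfolding halfspaces_def pt_convex_def by blast
  have "pt_interval X R a b \<subseteq> (\<Union>i\<in>I. A i)" if ab: "a \<in> (\<Union>i\<in>I. A i)" "b \<in> (\<Union>i\<in>I. A i)" for a b
  proof -
    obtain i j where "i \<in> I" "j \<in> I" "a \<in> A i" "b \<in> A j" using ab by blast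
    then show ?thesis using chain[of i j] 2[of i a b] 2[of j a b] by blast
  qed
  moreover have "pt_interval X R a b \<subseteq> X - (\<Union>i\<in>I. A i)"
    if "a \<in> X - (\<Union>i\<in>I. A i)" "b \<in> X - (\<Union>i\<in>I. A i)" for a b
    using that 3 by (fastforce simp: pt_interval_def)
  ultimately show ?thesis
    using 1 by (simp add: halfspaces_def pt_convex_def UN_subset_iff)
qed

lemma dyadic_between:
  fixes s t :: real
  assumes "0 \<le> s" "s < t"
  obtains q where "q \<in> dyadics" "s < q" "q < t"
proof -
  obtain n where n: "1 / 2 ^ n < t - s"
    using real_arch_pow_inv[of "t - s" "1/2"] assms by (auto simp: power_divide)
  define k where "k = nat \<lfloor>s * 2 ^ n\<rfloor> + 1"
  have "s * 2 ^ n < real k" "real k \<le> s * 2 ^ n + 1"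
    using assms unfolding k_def by (simp_all, linarith+)
  moreover have "1 < t * 2^n - s * 2 ^ n" using n by (simp add: field_simps)
  ultimately have "s < real k / 2 ^ n" "real k / 2 ^ n < t"
    by (simp_all add: field_simps)
  then show ?thesis using that[of "real k / 2 ^ n"] by (auto simp: dyadics_def)
qed

text \<open>The Urysohn construction along a nested family of open halfspaces: the superlevel sets of the
  resulting function are unions of chains of halfspaces.\<close>

lemma halfspace_urysohn:
  assumes hs: "\<And>q. q \<in> D \<Longrightarrow> A q \<in> halfspaces X R"
    and op: "\<And>q r. \<lbrakk>q \<in> D; r \<in> D; q < r\<rbrakk> \<Longrightarrow>
      \<exists>U. openin S U \<and> A r \<subseteq> U \<and> U \<subseteq> A q"
    and cl: "\<And>q. q \<in> D \<Longrightarrow> openin S (X - A q)"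
    and top: "topspace S = X"
    and D: "D = dyadics \<inter> {0..1::real}"
    and u: "\<And>q. \<lbrakk>q \<in> D; 0 < q\<rbrakk> \<Longrightarrow> u \<notin> A q" and v: "v \<in> A 1"
    and empty: "{} \<in> halfspaces X R" and full: "X \<in> halfspaces X R"
  shows "\<exists>f. continuous_map S euclideanreal f \<and> (\<forall>x. 0 \<le> f x \<and> f x \<le> 1) \<and>
    (\<forall>t. {x \<in> X. t < f x} \<in> halfspaces X R) \<and> f u \<noteq> f v"
proof -
  \<comment> \<open>The sets \<open>A q\<close> shrink as \<open>q\<close> grows, so
    \<open>f x\<close> is the level at which they lose \<open>x\<close>; \<open>insert 0\<close>
    provides for points in none of them.\<close>
  define f where "f x = Sup (insert 0 {q \<in> D. x \<in> A q})" for x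
  have D01: "q \<in> D \<Longrightarrow> 0 \<le> q \<and> q \<le> 1" for q using D by auto
  have D1: "1 \<in> D" "0 \<in> D" unfolding D dyadics_def
    by (auto intro: exI[of _ 0] exI[of _ 1])
  have bdd: "bdd_above (insert 0 {q \<in> D. x \<in> A q})" for x
    by (rule bdd_aboveI[of _ 1]) (auto dest: D01)
  have mono: "A r \<subseteq> A q" if "q \<in> D" "r \<in> D" "q < r" for q r
    using op[OF that] by blast
  have between: "\<exists>q\<in>D. s < q \<and> q < t" if "0 \<le> s" "s < t" "t \<le> 1" for s t
    using dyadic_between[OF that(1,2)] that unfolding D by (metis IntI atLeastAtMost_iff less_eq_real_def order_trans)
  have f0: "0 \<le> f x" for x unfolding f_def by (rule cSup_upper[OF _ bdd]) auto
  have f1: "f x \<le> 1" for x unfolding f_def by (rule cSup_least) (auto dest: D01)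
  have gt: "t < f x \<longleftrightarrow> (\<exists>q\<in>D. t < q \<and> x \<in> A q)" if "0 \<le> t" for t x
    unfolding f_def less_cSup_iff[OF insert_not_empty bdd] using that by auto
  have lev: "{x \<in> X. t < f x} = (\<Union>q\<in>{q\<in>D. t < q}. A q)" if "0 \<le> t" for t
    using gt[OF that] halfspace_subset[OF hs] by blast
  have lev0: "{x \<in> X. t < f x} = X" if "t < 0" for t
    using f0 that by (auto intro: less_le_trans)
  have H: "{x \<in> X. t < f x} \<in> halfspaces X R" for t
  proof (cases "t < 0")
    case True
    then show ?thesis using lev0 full by simp
  next
    case False
    have "(\<Union>q\<in>{q\<in>D. t < q}. A q) \<in> halfspaces X R"
    proof (rule halfspaces_UN_chain)
      fix i j assume "i \<in> {q\<in>D. t < q}" "j \<in> {q\<in>D. t < q}"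
      then show "A i \<subseteq> A j \<or> A j \<subseteq> A i" using mono by (cases i j rule: linorder_cases) auto
    qed (use hs in auto)
    then show ?thesis using lev False by simp
  qed
  have up: "openin S {x \<in> X. t < f x}" for t
  proof (cases "t < 0")
    case True
    then show ?thesis using lev0 top by (metis openin_topspace)
  next
    case False
    show ?thesis
    proof (subst openin_subopen, intro ballI)
      fix x assume x: "x \<in> {x \<in> X. t < f x}"
      then obtain r where r: "r \<in> D" "t < r" "x \<in> A r" using gt False by auto
      \<comment> \<open>An open set is available only between two levels, so a second level is
        squeezed in between \<open>t\<close> and \<open>r\<close>.\<close>
      obtain q where q: "q \<in> D" "t < q" "q < r"
        using between[of t r] r False D01[OF r(1)] by auto
      obtain U where "openin S U" "A r \<subseteq> U" "U \<subseteq> A q" using op[OF q(1) r(1) q(3)] by blast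
      then show "\<exists>U. openin S U \<and> x \<in> U \<and> U \<subseteq> {x \<in> X. t < f x}"
        using r q gt False halfspace_subset[OF hs[OF q(1)]] by (intro exI[of _ U]) fastforce
    qed
  qed
  have low: "openin S {x \<in> X. f x < t}" for t
  proof (cases "t > 1")
    case True
    then have "{x \<in> X. f x < t} = X" using f1 by (auto intro: le_less_trans)
    then show ?thesis using top by (metis openin_topspace)
  next
    case False
    have "{x \<in> X. f x < t} = (\<Union>q\<in>{q\<in>D. q < t}. X - A q)"
    proof (intro equalityI subsetI)
      fix x assume x: "x \<in> {x \<in> X. f x < t}"
      then obtain q where q: "q \<in> D" "f x < q" "q < t" using between[of "f x" t] f0 False by auto
      then have "x \<notin> A q" using gt[OF f0, of x x] by auto
      then show "x \<in> (\<Union>q\<in>{q\<in>D. q < t}. X - A q)" using q x by auto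
    next
      fix x assume "x \<in> (\<Union>q\<in>{q\<in>D. q < t}. X - A q)"
      then obtain q where q: "q \<in> D" "q < t" "x \<in> X" "x \<notin> A q" by auto
      have "\<not> q < f x" using gt[of q x] q mono D01[OF q(1)] by blast
      then show "x \<in> {x \<in> X. f x < t}" using q by auto
    qed
    then show ?thesis using cl by (auto intro!: openin_Union simp del: UN_simps)
  qed
  have "continuous_map S euclideanreal f"
    unfolding continuous_map_upper_lower_semicontinuous_lt top using up low by auto
  moreover have "f u = 0"
  proof -
    have "\<not> 0 < f u" using gt[of 0 u] u by blast
    then show ?thesis using f0[of u] by simp
  qed
  moreover have "f v = 1"
  proof -
    have "1 \<le> f v" unfolding f_def by (rule cSup_upper[OF _ bdd]) (use v D1 in auto)
    then show ?thesis using f1[of v] by simp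
  qed
  ultimately show ?thesis using f0 f1 H by (intro exI[of _ f]) auto
qed

context median_pretree
begin

text \<open>\<open>shadow X R x v\<close> is the part of \<open>X\<close> hidden behind
  \<open>x\<close> as seen from \<open>v\<close>. A common point \<open>z\<close> of the two shadows
  would have each of \<open>x\<close> and \<open>y\<close> between \<open>z\<close> and the
  other.\<close>

lemma shadow_disjoint:
  assumes "(u, x, y) \<in> R" "(x, y, v) \<in> R" "x \<noteq> y"
  shows "shadow X R y u \<inter> shadow X R x v = {}"
proof (rule ccontr)
  assume "shadow X R y u \<inter> shadow X R x v \<noteq> {}"
  then obtain z where z: "(z, y, u) \<in> R" "(z, x, v) \<in> R"
    unfolding shadow_def pt_interval_def by blast
  have "(x, y, z) \<in> R"
    using R_inner[of u x y z] R_sym[of z y u] z assms by blast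
  moreover have "(y, x, z) \<in> R"
    using R_inner[of v y x z] R_sym[of z x v] R_sym[of x y v] z assms by blast
  ultimately show False using assms(3) R_antisym[of z x y] R_sym by blast
qed

text \<open>With \<open>shadow_disjoint\<close> it fits the open complement of a shadow between two
  nested shadows, as the Urysohn construction requires.\<close>

lemma shadow_cover: "\<lbrakk>(u, x, v) \<in> R\<rbrakk> \<Longrightarrow> X - shadow X R x v \<subseteq> shadow X R x u"
proof
  fix z assume uxv: "(u, x, v) \<in> R" and z: "z \<in> X - shadow X R x v"
  then have "(z, x, u) \<in> R"
    using R_cut[OF uxv, of z] R_sym[of u x z] R_in[OF uxv] by (auto simp: shadow_def pt_interval_def)
  then show "z \<in> shadow X R x u" using z R_in[OF uxv] by (auto simp: shadow_def pt_interval_def)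
qed

lemma continuous_monotone_separation:
  assumes uv: "u \<in> X" "v \<in> X" "u \<noteq> v"
  shows "\<exists>f. continuous_map (shadow_topology X R) euclideanreal f \<and> (\<forall>x. 0 \<le> f x \<and> f x \<le> 1) \<and>
    (\<forall>t. {x \<in> X. t < f x} \<in> halfspaces X R) \<and> f u \<noteq> f v"
proof -
  have empty: "{} \<in> halfspaces X R" using halfspace_compl[OF space_halfspace] by simp
  define less where "less x y \<longleftrightarrow> x \<noteq> y \<and> (u, x, y) \<in> R \<and> (u, y, v) \<in> R" for x y
  have lessD: "(u, x, v) \<in> R" "(x, y, v) \<in> R" "x \<in> X" "y \<in> X" "x \<noteq> v" "y \<noteq> u" if "less x y" for x y
  proof -
    have xy: "x \<noteq> y" "(u, x, y) \<in> R" "(u, y, v) \<in> R" using that unfolding less_def by auto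
    then show "(u, x, v) \<in> R" "(x, y, v) \<in> R" "x \<in> X" "y \<in> X"
      using R_trans[of u x y v] R_inner[of u x y v] R_in[of u x y] by auto
    then show "x \<noteq> v" "y \<noteq> u"
      using xy R_degenerate[of x y] R_degenerate[of u x] by auto
  qed
  show ?thesis
  proof (cases "\<forall>x y. less x y \<longrightarrow> (\<exists>z. less x z \<and> less z y)")
    case True
    have trans: "less x z" if "less x y" "less y z" for x y z
      using that R_trans[of u x y z] R_antisym[of u y x] unfolding less_def by blast
    have "less u v" unfolding less_def using uv R_refl by auto
    \<comment> \<open>A dense order receives the dyadic numbers of the unit interval, with
      \<open>u\<close> and \<open>v\<close> as the images of 0 and 1.\<close>
    have "\<exists>c :: real \<Rightarrow> 'a. c 0 = u \<and> c 1 = v \<and>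
        (\<forall>q \<in> dyadics \<inter> {0..1}. \<forall>r \<in> dyadics \<inter> {0..1}. q < r \<longrightarrow> less (c q) (c r))"
    proof (rule recursion_on_dyadic_fractions[of less u v])
      show "less u v" by fact
      show "\<exists>z. less x z \<and> less z y" if "less x y" for x y using True that by blast
    qed (rule trans)
    then obtain c :: "real \<Rightarrow> 'a" where c0: "c 0 = u" and c1: "c 1 = v"
      and c: "\<And>q r. \<lbrakk>q \<in> dyadics \<inter> {0..1}; r \<in> dyadics \<inter> {0..1}; q < r\<rbrakk> \<Longrightarrow> less (c q) (c r)"
      by blast
    define D where "D = dyadics \<inter> {0..1::real}"
    have pD: "0 \<in> D" "1 \<in> D" unfolding D_def dyadics_def
      by (auto intro: exI[of _ 0] exI[of _ 1])
    have cX: "c q \<in> X \<and> (u, c q, v) \<in> R" if "q \<in> D" for q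
    proof (cases "q = 0")
      case True
      then show ?thesis using c0 uv R_refl(2) by simp
    next
      case False
      then have "less (c 0) (c q)" using c[of 0 q] that pD unfolding D_def by auto
      then show ?thesis using lessD(4)[of "c 0" "c q"] unfolding less_def by blast
    qed
    show ?thesis
    proof (rule halfspace_urysohn[where A = "\<lambda>q. shadow X R (c q) u", OF _ _ _ topspace_shadow_topology D_def])
      show "shadow X R (c q) u \<in> halfspaces X R" if "q \<in> D" for q
        using shadow_halfspace cX that uv by blast
      show "\<exists>U. openin (shadow_topology X R) U \<and> shadow X R (c r) u \<subseteq> U \<and> U \<subseteq> shadow X R (c q) u"
        if "q \<in> D" "r \<in> D" "q < r" for q r
      proof -
        have qr: "less (c q) (c r)" using c that unfolding D_def by blast
        \<comment> \<open>The open set between the two levels is the complement of what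
          \<open>c q\<close> hides from \<open>v\<close>.\<close>
        have "shadow X R (c r) u \<inter> shadow X R (c q) v = {}"
          using shadow_disjoint[of u "c q" "c r" v] qr lessD(2)[OF qr] unfolding less_def by blast
        moreover have "shadow X R (c r) u \<subseteq> X" by (auto simp: shadow_def)
        ultimately show ?thesis
          using openin_shadow_compl[of "c q" X v R] shadow_cover[of u "c q" v] lessD[OF qr] uv
          by (intro exI[of _ "X - shadow X R (c q) v"] conjI; blast)
      qed
      \<comment> \<open>Subbasic closed sets are formed from distinct points only. If
        \<open>c q = u\<close>, the shadow degenerates to the whole space.\<close>
      show "openin (shadow_topology X R) (X - shadow X R (c q) u)" if "q \<in> D" for q
      proof (cases "c q = u")
        case True
        then have "shadow X R (c q) u = X" using uv R_refl by (auto simp: shadow_def pt_interval_def)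
        then show ?thesis by simp
      next
        case False
        then show ?thesis using openin_shadow_compl[of "c q" X u R] cX[OF that] uv by blast
      qed
      show "u \<notin> shadow X R (c q) u" if "q \<in> D" "0 < q" for q
      proof -
        have "less (c 0) (c q)" using c[of 0 q] that pD unfolding D_def by auto
        then have "c q \<noteq> u" using lessD(6) by blast
        then show ?thesis using R_degenerate[of u "c q"] unfolding shadow_def pt_interval_def by blast
      qed
      show "v \<in> shadow X R (c 1) u"
        using uv R_refl c1 by (auto simp: shadow_def pt_interval_def)
    qed (use empty space_halfspace in auto)
  next
    case False
    \<comment> \<open>At a jump the interval between \<open>x\<close> and \<open>y\<close> is
      \<open>{x, y}\<close>, so the median of \<open>x\<close>, \<open>y\<close>, \<open>z\<close>
      is one of these two and every \<open>z\<close> is hidden behind \<open>y\<close> from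
      \<open>u\<close> or behind \<open>x\<close> from \<open>v\<close>. The two closed shadows
      partition \<open>X\<close>, hence are clopen.\<close>
    then obtain x y where xy: "less x y" and gap: "\<And>z. \<not> (less x z \<and> less z y)" by blast
    define A where "A = shadow X R y u"
    have A: "A \<in> halfspaces X R" unfolding A_def using shadow_halfspace lessD(4)[OF xy] uv by blast
    have "\<exists>m. (x, m, y) \<in> R \<and> (x, m, z) \<in> R \<and> (y, m, z) \<in> R" if "z \<in> X" for z
      using median[of x y z] lessD[OF xy] that unfolding pt_interval_def by blast
    moreover have "m = x \<or> m = y" if "(x, m, y) \<in> R" for m
    proof -
      have 1: "(u, x, m) \<in> R"
        using R_inner[of y m x u] R_sym that xy unfolding less_def by blast
      have 2: "(u, m, y) \<in> R"
        using R_trans[of y m x u] that xy R_sym unfolding less_def by blast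
      have 3: "(u, y, v) \<in> R" using xy unfolding less_def by blast
      then show ?thesis using gap[of m] 1 2 R_trans[OF 2 3] unfolding less_def by blast
    qed
    ultimately have "(y, x, z) \<in> R \<or> (x, y, z) \<in> R" if "z \<in> X" for z using that by blast
    then have cover: "z \<in> shadow X R y u \<or> z \<in> shadow X R x v" if z: "z \<in> X" for z
    proof (cases "(y, x, z) \<in> R")
      case True
      then have "(z, x, v) \<in> R" using R_cut[of z x y v] R_sym[of y x z] R_sym[of x y v] lessD[OF xy] uv xy
          R_antisym[of v x y] unfolding less_def by blast
      then show ?thesis using z lessD[OF xy] by (auto simp: shadow_def pt_interval_def)
    next
      case False
      then have "(x, y, z) \<in> R" using \<open>\<And>z. z \<in> X \<Longrightarrow> (y, x, z) \<in> R \<or> (x, y, z) \<in> R\<close> z by blast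
      then have "(z, y, u) \<in> R" using R_cut[of z y x u] R_sym[of x y z] R_sym[of u y x] lessD[OF xy] uv xy
          R_antisym[of u x y] unfolding less_def by blast
      then show ?thesis using z lessD[OF xy] by (auto simp: shadow_def pt_interval_def)
    qed
    have AB: "X - A = shadow X R x v"
      using cover shadow_disjoint[of u x y v] lessD[OF xy] xy
      unfolding A_def less_def shadow_def by blast
    have "A = X - shadow X R x v" using AB halfspace_subset[OF A] by blast
    then have op: "openin (shadow_topology X R) A" "openin (shadow_topology X R) (X - A)"
      using openin_shadow_compl[of x X v R] openin_shadow_compl[of y X u R] lessD[OF xy] uv
      unfolding A_def by simp_all
    define f where "f z = (if z \<in> A then 1 else 0 :: real)" for z
    have 1: "{z \<in> X. t < f z} = (if t < 0 then X else if t < 1 then A else {})" for t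
      using halfspace_subset[OF A] by (auto simp: f_def)
    have 2: "{z \<in> X. f z < t} = (if t \<le> 0 then {} else if t \<le> 1 then X - A else X)" for t
      by (auto simp: f_def)
    have "continuous_map (shadow_topology X R) euclideanreal f"
      unfolding continuous_map_upper_lower_semicontinuous_lt topspace_shadow_topology 1 2
      using op openin_topspace[of "shadow_topology X R"] by auto
    moreover have "v \<in> A" unfolding A_def shadow_def pt_interval_def
      using xy lessD[OF xy] R_sym uv unfolding less_def by blast
    moreover have "u \<notin> A" unfolding A_def shadow_def pt_interval_def
      using lessD[OF xy] R_degenerate by blast
    moreover have "\<forall>t. {z \<in> X. t < f z} \<in> halfspaces X R"
      using A empty space_halfspace by (simp add: 1)
    ultimately show ?thesis
      by (intro exI[of _ f]) (simp add: f_def)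
  qed
qed

end

section \<open>Separated pairs in a nested family of halfspaces\<close>

text \<open>The interface between pretrees and Banach spaces: betweenness does not occur again until
  the final instantiation.\<close>

locale nested_halfspaces =
  fixes S :: "'a topology" and HS :: "'a set set"
  assumes HS_subset: "H \<in> HS \<Longrightarrow> H \<subseteq> topspace S"
    and HS_space: "topspace S \<in> HS"
    and HS_compl: "H \<in> HS \<Longrightarrow> topspace S - H \<in> HS"
    and HS_nested: "\<lbrakk>H \<in> HS; T \<in> HS; a \<in> H \<inter> T; b \<in> T - H; c \<in> H - T\<rbrakk>
      \<Longrightarrow> topspace S - (H \<union> T) = {}"
    and compact: "compact_space S"
    and separation: "\<lbrakk>u \<in> topspace S; v \<in> topspace S; u \<noteq> v\<rbrakk> \<Longrightarrow>
      \<exists>f. continuous_map S euclideanreal f \<and> (\<forall>x. 0 \<le> f x \<and> f x \<le> 1) \<and>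
        (\<forall>t. {x \<in> topspace S. t < f x} \<in> HS) \<and> f u \<noteq> f v"
begin

definition separates :: "'a set \<Rightarrow> 'a \<times> 'a \<Rightarrow> bool"
  where "separates H p \<longleftrightarrow> (fst p \<in> H) \<noteq> (snd p \<in> H)"

text \<open>In a tree these are the finite families of paths no two of which share an edge.\<close>

definition admissible :: "('a \<times> 'a) set \<Rightarrow> bool"
  where "admissible P \<longleftrightarrow> finite P \<and> P \<subseteq> topspace S \<times> topspace S \<and>
    (\<forall>H\<in>HS. \<forall>p\<in>P. \<forall>q\<in>P. separates H p \<and> separates H q \<longrightarrow> p = q)"

lemma admissible_empty [simp]: "admissible {}"
  by (simp add: admissible_def)

text \<open>Two points inside a halfspace meeting F in as few points as possible, but at least two, are
  paired first: by nestedness no halfspace separates them and also two of the remaining points.\<close>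

lemma admissible_pairing:
  assumes "finite F" "F \<subseteq> topspace S"
  shows "\<exists>P. admissible P \<and> P \<subseteq> F \<times> F \<and> (\<forall>(a, b)\<in>P. a \<noteq> b) \<and> card P = card F div 2"
  using assms
proof (induction "card F" arbitrary: F rule: less_induct)
  case less
  show ?case
  proof (cases "card F < 2")
    case True
    then show ?thesis by (intro exI[of _ "{}"]) auto
  next
    case False
    define Q where "Q H \<longleftrightarrow> H \<in> HS \<and> 2 \<le> card (H \<inter> F)" for H
    have "Q (topspace S)"
      using False less.prems HS_space unfolding Q_def by (simp add: Int_absorb1)
    then obtain H where H: "Q H" and min: "\<And>T. Q T \<Longrightarrow> card (H \<inter> F) \<le> card (T \<inter> F)"
      using arg_min_nat_lemma[of Q "topspace S" "\<lambda>H. card (H \<inter> F)"] by blast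
    obtain a b where ab: "a \<in> H \<inter> F" "b \<in> H \<inter> F" "a \<noteq> b"
    proof -
      have "2 \<le> card (H \<inter> F)" using H Q_def by blast
      then obtain B where "B \<subseteq> H \<inter> F" "card B = 2"
        using obtain_subset_with_card_n by metis
      then show ?thesis using that by (auto simp: card_2_iff)
    qed
    define F' where "F' = F - {a, b}"
    have cF: "card F = card F' + 2"
      using ab less.prems False unfolding F'_def by (simp add: card_Diff_subset)
    obtain P where P: "admissible P" "P \<subseteq> F' \<times> F'" "\<forall>(a, b)\<in>P. a \<noteq> b" "card P = card F' div 2"
      using less.hyps[of F'] cF less.prems unfolding F'_def by auto
    \<comment> \<open>\<open>T\<close> separates \<open>a'\<close> from \<open>b'\<close> and
      \<open>c\<close> from \<open>d\<close>. If \<open>T \<subseteq> H\<close>, then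
      \<open>T\<close> contains \<open>a'\<close> and \<open>c\<close> but not \<open>b'\<close>.
      Otherwise nestedness puts the complement of \<open>T\<close> inside \<open>H\<close>, and it
      contains \<open>b'\<close> and \<open>d\<close> but not \<open>a'\<close>. Either way a
      halfspace with at least two points of \<open>F\<close> beats the minimal
      \<open>H\<close>.\<close>
    have key: False if T: "T \<in> HS" and a': "a' \<in> T \<inter> H \<inter> F" and b': "b' \<in> H \<inter> F - T"
      and c: "c \<in> F" "c \<in> T" "c \<noteq> a'" and d: "d \<in> F" "d \<notin> T" "d \<noteq> b'" for T a' b' c d
    proof -
      have less_card: "\<not> (T' \<in> HS \<and> T' \<inter> F \<subset> H \<inter> F \<and> x \<in> T' \<inter> F \<and> y \<in> T' \<inter> F \<and> x \<noteq> y)" for T' x y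
      proof
        assume A: "T' \<in> HS \<and> T' \<inter> F \<subset> H \<inter> F \<and> x \<in> T' \<inter> F \<and> y \<in> T' \<inter> F \<and> x \<noteq> y"
        have fin: "finite (T' \<inter> F)" "finite (H \<inter> F)" using less.prems by auto
        have "card {x, y} \<le> card (T' \<inter> F)" using A fin by (intro card_mono) auto
        then have "Q T'" using A unfolding Q_def by auto
        moreover have "card (T' \<inter> F) < card (H \<inter> F)" using A fin by (intro psubset_card_mono) auto
        ultimately show False using min by force
      qed
      show False
      proof (cases "T - H = {}")
        case True
        then show False using less_card[of T a' c] T a' b' c by blast
      next
        case False
        then obtain e where "e \<in> T - H" by blast
        then have "topspace S - (H \<union> T) = {}"
          using HS_nested[of H T a' e b'] T H a' b' unfolding Q_def by blast
        then have "(topspace S - T) \<inter> F \<subset> H \<inter> F" using a' by blast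
        then show False
          using less_card[of "topspace S - T" b' d] HS_compl[OF T] b' d less.prems by blast
      qed
    qed
    have sep: False if T: "T \<in> HS" and s: "separates T (a, b)" "separates T p" and p: "p \<in> P" for T p
    proof -
      obtain c d where cd: "p = (c, d) \<or> p = (d, c)" "c \<in> T" "d \<notin> T"
        using s unfolding separates_def by (metis prod.collapse)
      then have "c \<in> F" "d \<in> F" "c \<noteq> a" "c \<noteq> b" "d \<noteq> a" "d \<noteq> b"
        using p P(2) unfolding F'_def by auto
      then show False
        using key[of T a b c d] key[of T b a c d] T s(1) cd ab unfolding separates_def by auto
    qed
    have notin: "(a, b) \<notin> P" using P(2) unfolding F'_def by auto
    have "admissible (insert (a, b) P)"
      unfolding admissible_def
    proof (intro conjI ballI impI)
      show "finite (insert (a, b) P)" using P unfolding admissible_def by auto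
      show "insert (a, b) P \<subseteq> topspace S \<times> topspace S"
        using P ab less.prems unfolding admissible_def by auto
      show "p = q" if "T \<in> HS" "p \<in> insert (a, b) P" "q \<in> insert (a, b) P"
        "separates T p \<and> separates T q" for T p q
        using that sep P(1) unfolding admissible_def by blast
    qed
    moreover have "card (insert (a, b) P) = card F div 2"
      using notin P unfolding admissible_def by (simp add: cF)
    moreover have "insert (a, b) P \<subseteq> F \<times> F" using P(2) ab unfolding F'_def by blast
    ultimately show ?thesis using P(3) ab by (intro exI[of _ "insert (a, b) P"]) auto
  qed
qed

text \<open>The intervals spanned by the values of f on an admissible family are disjoint, since a common
  point t makes a superlevel set separate two pairs.\<close>

lemma monotone_variation:
  assumes f: "\<And>x. 0 \<le> f x \<and> f x \<le> (1::real)" and lev: "\<And>t. {x \<in> topspace S. t < f x} \<in> HS"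
    and P: "admissible P"
  shows "(\<Sum>p\<in>P. \<bar>f (fst p) - f (snd p)\<bar>) \<le> 1"
proof -
  \<comment> \<open>Closed on the left and open on the right, because the strict superlevel set at
    \<open>t\<close> separates \<open>p\<close> exactly when \<open>t\<close> is at least the
    smaller and below the larger value.\<close>
  define I where "I p = {min (f (fst p)) (f (snd p))..<max (f (fst p)) (f (snd p))}" for p
  have fin: "finite P" using P unfolding admissible_def by blast
  have disj: "disjoint_family_on I P"
    unfolding disjoint_family_on_def
  proof (intro ballI impI, rule ccontr)
    fix p q assume pq: "p \<in> P" "q \<in> P" "p \<noteq> q" "I p \<inter> I q \<noteq> {}"
    then obtain t where t: "t \<in> I p" "t \<in> I q" by blast
    let ?H = "{x \<in> topspace S. t < f x}"
    have "separates ?H r" if "t \<in> I r" "r \<in> P" for r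
      using that P unfolding separates_def I_def admissible_def
      by (auto simp: min_def max_def split: if_splits)
    then show False using P pq t lev[of t] unfolding admissible_def by blast
  qed
  have "(\<Sum>p\<in>P. \<bar>f (fst p) - f (snd p)\<bar>) = (\<Sum>p\<in>P. measure lborel (I p))"
    by (rule sum.cong) (auto simp: I_def min_def max_def)
  also have "\<dots> = measure lborel (\<Union>p\<in>P. I p)"
  proof (rule measure_finite_Union[symmetric, OF fin _ disj])
    show "emeasure lborel (I p) \<noteq> \<infinity>" for p by (simp add: I_def emeasure_lborel_Ico)
  qed (auto simp: I_def)
  also have "\<dots> \<le> measure lborel {0..1::real}"
  proof (rule measure_mono_fmeasurable)
    have "t \<in> {0..1}" if "t \<in> I p" for t p
      using that f[of "fst p"] f[of "snd p"] by (auto simp: I_def min_def max_def split: if_splits)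
    then show "(\<Union>p\<in>P. I p) \<subseteq> {0..1}" by blast
    show "(\<Union>p\<in>P. I p) \<in> sets lborel" using fin by (auto simp: I_def)
  qed (auto intro!: fmeasurableI)
  finally show ?thesis by simp
qed

end

section \<open>The Banach space of functions of bounded quadratic variation\<close>

context nested_halfspaces
begin

definition osc :: "('a \<Rightarrow> real) \<Rightarrow> ('a \<times> 'a) set \<Rightarrow> real"
  where "osc v P = L2_set (\<lambda>p. v (fst p) - v (snd p)) P"

text \<open>Vanishing off the carrier makes the norm definite on total functions. As
  \<open>x\<close> and \<open>P\<close> vary independently, bounding the sum amounts to bounding the
  sup norm and the quadratic variation separately, and the norm becomes one supremum of
  seminorms.\<close>

definition QV :: "('a \<Rightarrow> real) set"
  where "QV = {v. (\<forall>x. x \<notin> topspace S \<longrightarrow> v x = 0) \<and>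
    (\<exists>B. \<forall>x P. admissible P \<longrightarrow> \<bar>v x\<bar> + osc v P \<le> B)}"

text \<open>Outside QV the supremum is a junk value; 0 makes the norm nonnegative and even everywhere, as
  the locale Metric_space demands of the induced distance.\<close>

definition qnorm :: "('a \<Rightarrow> real) \<Rightarrow> real"
  where "qnorm v = (if v \<in> QV then SUP (x, P)\<in>UNIV \<times> Collect admissible. \<bar>v x\<bar> + osc v P else 0)"

definition BV :: "('a \<Rightarrow> real) set"
  where "BV = {w. (\<forall>x. x \<notin> topspace S \<longrightarrow> w x = 0) \<and> continuous_map S euclideanreal w \<and>
    (\<exists>B. \<forall>x. \<bar>w x\<bar> \<le> B) \<and> (\<exists>B. \<forall>P. admissible P \<longrightarrow> (\<Sum>p\<in>P. \<bar>w (fst p) - w (snd p)\<bar>) \<le> B)}"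

text \<open>Closing up \<open>BV\<close> keeps all members continuous and reduces strong continuity
  of the action and the choice of blocks to functions whose quadratic variation is small once their
  sup norm is.\<close>

definition QV0 :: "('a \<Rightarrow> real) set"
  where "QV0 = {v \<in> QV. \<forall>e>0. \<exists>w\<in>BV. qnorm (v - w) < e}"

lemma osc_nonneg [simp]: "0 \<le> osc v P"
  by (simp add: osc_def)

lemma osc_zero [simp]: "osc 0 P = 0"
  by (simp add: osc_def L2_set_def)

lemma osc_add: "osc (v + w) P \<le> osc v P + osc w P"
  using L2_set_triangle_ineq[of "\<lambda>p. v (fst p) - v (snd p)" "\<lambda>p. w (fst p) - w (snd p)" P]
  by (simp add: osc_def algebra_simps)

lemma osc_scaleR: "osc (c *\<^sub>R v) P = \<bar>c\<bar> * osc v P"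
proof -
  have "osc (c *\<^sub>R v) P = L2_set (\<lambda>p. c * (v (fst p) - v (snd p))) P"
    by (simp add: osc_def scaleR_fun_def algebra_simps)
  also have "\<dots> = \<bar>c\<bar> * osc v P"
    by (simp add: osc_def L2_set_def power_mult_distrib real_sqrt_mult flip: sum_distrib_left)
  finally show ?thesis .
qed

lemma osc_le_variation:
  assumes "\<And>x. \<bar>w x\<bar> \<le> M" "(\<Sum>p\<in>P. \<bar>w (fst p) - w (snd p)\<bar>) \<le> B"
  shows "osc w P \<le> sqrt (2 * M * B)"
proof -
  have M: "0 \<le> M" using order_trans[OF abs_ge_zero assms(1)] .
  have "(\<Sum>p\<in>P. (w (fst p) - w (snd p))\<^sup>2) \<le> (\<Sum>p\<in>P. 2 * M * \<bar>w (fst p) - w (snd p)\<bar>)"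
  proof (rule sum_mono)
    fix p
    have "\<bar>w (fst p) - w (snd p)\<bar> \<le> 2 * M" using assms(1)[of "fst p"] assms(1)[of "snd p"] by linarith
    then have "\<bar>w (fst p) - w (snd p)\<bar> * \<bar>w (fst p) - w (snd p)\<bar> \<le> 2 * M * \<bar>w (fst p) - w (snd p)\<bar>"
      by (intro mult_right_mono) auto
    then show "(w (fst p) - w (snd p))\<^sup>2 \<le> 2 * M * \<bar>w (fst p) - w (snd p)\<bar>"
      by (simp add: power2_eq_square)
  qed
  also have "\<dots> = 2 * M * (\<Sum>p\<in>P. \<bar>w (fst p) - w (snd p)\<bar>)" by (simp add: sum_distrib_left)
  also have "\<dots> \<le> 2 * M * B" using assms(2) M by (intro mult_left_mono) auto
  finally show ?thesis by (simp add: osc_def L2_set_def)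
qed

lemma QV_I:
  "\<lbrakk>\<And>x. x \<notin> topspace S \<Longrightarrow> v x = 0; \<And>x P. admissible P \<Longrightarrow> \<bar>v x\<bar> + osc v P \<le> B\<rbrakk> \<Longrightarrow> v \<in> QV"
  unfolding QV_def by blast

lemma QV_outside: "\<lbrakk>v \<in> QV; x \<notin> topspace S\<rbrakk> \<Longrightarrow> v x = 0"
  unfolding QV_def by blast

lemma qnorm_upper:
  assumes "v \<in> QV" "admissible P"
  shows "\<bar>v x\<bar> + osc v P \<le> qnorm v"
proof -
  obtain B where B: "\<And>x P. admissible P \<Longrightarrow> \<bar>v x\<bar> + osc v P \<le> B"
    using assms unfolding QV_def by blast
  have "bdd_above ((\<lambda>(x, P). \<bar>v x\<bar> + osc v P) ` (UNIV \<times> Collect admissible))"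
    by (rule bdd_aboveI[of _ B]) (auto intro: B)
  from cSUP_upper[OF _ this, of "(x, P)"] show ?thesis using assms unfolding qnorm_def by simp
qed

lemma qnorm_least:
  assumes "v \<in> QV" "\<And>x P. admissible P \<Longrightarrow> \<bar>v x\<bar> + osc v P \<le> B"
  shows "qnorm v \<le> B"
proof -
  have "(SUP (x, P)\<in>UNIV \<times> Collect admissible. \<bar>v x\<bar> + osc v P) \<le> B"
    using assms(2) by (intro cSUP_least) (auto intro!: exI[of _ "{}"])
  then show ?thesis using assms unfolding qnorm_def by simp
qed

lemma abs_le_qnorm: "v \<in> QV \<Longrightarrow> \<bar>v x\<bar> \<le> qnorm v"
  using qnorm_upper[of v "{}" x] by (simp add: osc_def)

lemma osc_le_qnorm: "\<lbrakk>v \<in> QV; admissible P\<rbrakk> \<Longrightarrow> osc v P \<le> qnorm v"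
  using qnorm_upper[of v P undefined] by linarith

lemma qnorm_nonneg: "0 \<le> qnorm v"
proof (cases "v \<in> QV")
  case True
  then show ?thesis using abs_le_qnorm order_trans[OF abs_ge_zero] by blast
qed (simp add: qnorm_def)

lemma QV_zero: "0 \<in> QV"
  by (rule QV_I[of _ 0]) auto

lemma QV_add:
  assumes "v \<in> QV" "w \<in> QV"
  shows "v + w \<in> QV" "qnorm (v + w) \<le> qnorm v + qnorm w"
proof -
  have *: "\<bar>(v + w) x\<bar> + osc (v + w) P \<le> qnorm v + qnorm w" if "admissible P" for x P
    using qnorm_upper[OF assms(1) that, of x] qnorm_upper[OF assms(2) that, of x] osc_add[of v w P]
    by (simp add: plus_fun_def)
  show 1: "v + w \<in> QV"
    by (rule QV_I[OF _ *]) (auto simp: plus_fun_def QV_outside assms)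
  show "qnorm (v + w) \<le> qnorm v + qnorm w" by (rule qnorm_least[OF 1 *])
qed

lemma QV_scaleR:
  assumes "v \<in> QV"
  shows "c *\<^sub>R v \<in> QV" "qnorm (c *\<^sub>R v) = \<bar>c\<bar> * qnorm v"
proof -
  have *: "c *\<^sub>R v \<in> QV \<and> qnorm (c *\<^sub>R v) \<le> \<bar>c\<bar> * qnorm v" if v: "v \<in> QV" for c v
  proof -
    have *: "\<bar>(c *\<^sub>R v) x\<bar> + osc (c *\<^sub>R v) P \<le> \<bar>c\<bar> * qnorm v" if "admissible P" for x P
      using mult_left_mono[OF qnorm_upper[OF v that, of x], of "\<bar>c\<bar>"]
      by (simp add: osc_scaleR distrib_left) (simp add: scaleR_fun_def abs_mult)
    have 1: "c *\<^sub>R v \<in> QV"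
      by (rule QV_I[OF _ *]) (auto simp: scaleR_fun_def QV_outside v)
    then show ?thesis using qnorm_least[OF 1 *] by blast
  qed
  show 1: "c *\<^sub>R v \<in> QV" using * assms by blast
  show "qnorm (c *\<^sub>R v) = \<bar>c\<bar> * qnorm v"
  proof (cases "c = 0")
    case True
    then show ?thesis using *[OF assms, of 0] qnorm_nonneg[of "0 *\<^sub>R v"] by simp
  next
    case False
    have "qnorm v \<le> \<bar>1 / c\<bar> * qnorm (c *\<^sub>R v)" using *[OF 1, of "1 / c"] False by simp
    then have "\<bar>c\<bar> * qnorm v \<le> qnorm (c *\<^sub>R v)" using False by (simp add: field_simps)
    then show ?thesis using *[OF assms, of c] by linarith
  qed
qed

lemma qnorm_zero [simp]: "qnorm 0 = 0"
  using QV_scaleR(2)[OF QV_zero, of 0] by simp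

lemma QV_uminus: "- v \<in> QV \<longleftrightarrow> v \<in> QV"
  using QV_scaleR(1)[of v "-1"] QV_scaleR(1)[of "- v" "-1"] by auto

lemma qnorm_uminus: "qnorm (- v) = qnorm v"
  using QV_scaleR(2)[of v "-1"] QV_uminus[of v] by (cases "v \<in> QV") (auto simp: qnorm_def)

lemma QV_diff:
  assumes "v \<in> QV" "w \<in> QV"
  shows "v - w \<in> QV" "qnorm (v - w) \<le> qnorm v + qnorm w"
  using QV_add[of v "- w"] assms by (simp_all add: QV_uminus qnorm_uminus)

lemma QV_sum:
  assumes "\<And>i. i \<in> I \<Longrightarrow> v i \<in> QV"
  shows "sum v I \<in> QV" "qnorm (sum v I) \<le> (\<Sum>i\<in>I. qnorm (v i))"
proof -
  have "sum v I \<in> QV \<and> qnorm (sum v I) \<le> (\<Sum>i\<in>I. qnorm (v i))"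
    using assms
  proof (induction I rule: infinite_finite_induct)
    case (insert i I)
    then have "v i \<in> QV" "sum v I \<in> QV" "qnorm (sum v I) \<le> (\<Sum>i\<in>I. qnorm (v i))" by auto
    then have "v i + sum v I \<in> QV" "qnorm (v i + sum v I) \<le> qnorm (v i) + (\<Sum>i\<in>I. qnorm (v i))"
      using QV_add[of "v i" "sum v I"] by auto
    then show ?case unfolding sum.insert[OF insert.hyps] by blast
  qed (auto simp: QV_zero)
  then show "sum v I \<in> QV" "qnorm (sum v I) \<le> (\<Sum>i\<in>I. qnorm (v i))" by auto
qed

lemma qnorm_eq_0: "v \<in> QV \<Longrightarrow> qnorm v = 0 \<longleftrightarrow> v = 0"
  using abs_le_qnorm[of v] qnorm_zero by fastforce

lemma BV_outside: "\<lbrakk>w \<in> BV; x \<notin> topspace S\<rbrakk> \<Longrightarrow> w x = 0"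
  unfolding BV_def by blast

lemma BV_QV:
  assumes "w \<in> BV"
  shows "w \<in> QV"
proof -
  obtain B M where B: "\<And>x. \<bar>w x\<bar> \<le> M"
    "\<And>P. admissible P \<Longrightarrow> (\<Sum>p\<in>P. \<bar>w (fst p) - w (snd p)\<bar>) \<le> B"
    using assms unfolding BV_def by blast
  show ?thesis
    by (rule QV_I[of _ "M + sqrt (2 * M * B)"])
      (use B osc_le_variation[of w M] BV_outside[OF assms] in \<open>auto intro: add_mono\<close>)
qed

lemma BV_zero: "0 \<in> BV"
  unfolding BV_def by (auto simp: zero_fun_def)

lemma BV_add:
  assumes "v \<in> BV" "w \<in> BV"
  shows "v + w \<in> BV"
proof -
  obtain B M B' M' where B: "\<And>x. \<bar>v x\<bar> \<le> M" "\<And>x. \<bar>w x\<bar> \<le> M'"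
    "\<And>P. admissible P \<Longrightarrow> (\<Sum>p\<in>P. \<bar>v (fst p) - v (snd p)\<bar>) \<le> B"
    "\<And>P. admissible P \<Longrightarrow> (\<Sum>p\<in>P. \<bar>w (fst p) - w (snd p)\<bar>) \<le> B'"
    using assms unfolding BV_def by blast
  have "\<bar>(v + w) x\<bar> \<le> M + M'" for x
    using B(1)[of x] B(2)[of x] by (simp add: plus_fun_def)
  moreover have "(\<Sum>p\<in>P. \<bar>(v + w) (fst p) - (v + w) (snd p)\<bar>) \<le> B + B'" if "admissible P" for P
  proof -
    have "(\<Sum>p\<in>P. \<bar>(v + w) (fst p) - (v + w) (snd p)\<bar>) \<le>
        (\<Sum>p\<in>P. \<bar>v (fst p) - v (snd p)\<bar> + \<bar>w (fst p) - w (snd p)\<bar>)"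
      by (rule sum_mono) (simp add: plus_fun_def)
    then show ?thesis using B(3,4)[OF that] by (simp add: sum.distrib)
  qed
  moreover have "continuous_map S euclideanreal (v + w)"
    using assms unfolding BV_def plus_fun_def by (auto intro: continuous_map_add)
  moreover have "(v + w) x = 0" if "x \<notin> topspace S" for x
    using that BV_outside[OF assms(1)] BV_outside[OF assms(2)] by (simp add: plus_fun_def)
  ultimately show ?thesis unfolding BV_def by blast
qed

lemma BV_scaleR:
  assumes "w \<in> BV"
  shows "c *\<^sub>R w \<in> BV"
proof -
  obtain B M where B: "\<And>x. \<bar>w x\<bar> \<le> M"
    "\<And>P. admissible P \<Longrightarrow> (\<Sum>p\<in>P. \<bar>w (fst p) - w (snd p)\<bar>) \<le> B"
    using assms unfolding BV_def by blast
  have "\<bar>(c *\<^sub>R w) x\<bar> \<le> \<bar>c\<bar> * M" for x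
    using B(1)[of x] by (simp add: scaleR_fun_def abs_mult mult_left_mono)
  moreover have "(\<Sum>p\<in>P. \<bar>(c *\<^sub>R w) (fst p) - (c *\<^sub>R w) (snd p)\<bar>) \<le> \<bar>c\<bar> * B" if "admissible P" for P
  proof -
    have "(\<Sum>p\<in>P. \<bar>(c *\<^sub>R w) (fst p) - (c *\<^sub>R w) (snd p)\<bar>) = \<bar>c\<bar> * (\<Sum>p\<in>P. \<bar>w (fst p) - w (snd p)\<bar>)"
      by (simp add: scaleR_fun_def sum_distrib_left abs_mult flip: right_diff_distrib)
    then show ?thesis using B(2)[OF that] by (simp add: mult_left_mono)
  qed
  moreover have "continuous_map S euclideanreal (c *\<^sub>R w)"
    using assms unfolding BV_def scaleR_fun_def real_scaleR_def
    by (auto intro: continuous_map_real_mult_left)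
  moreover have "(c *\<^sub>R w) x = 0" if "x \<notin> topspace S" for x
    using that assms BV_outside by (simp add: scaleR_fun_def)
  ultimately show ?thesis unfolding BV_def by blast
qed

lemma BV_QV0: "w \<in> BV \<Longrightarrow> w \<in> QV0"
  unfolding QV0_def using BV_QV by (auto intro!: bexI[of _ w])

lemma QV0_QV: "v \<in> QV0 \<Longrightarrow> v \<in> QV"
  unfolding QV0_def by blast

lemma QV0_approx:
  assumes "v \<in> QV0" "0 < e"
  obtains w where "w \<in> BV" "qnorm (v - w) < e"
  using assms unfolding QV0_def by blast

lemma subspace_QV0: "subspace QV0"
  unfolding subspace_def
proof (intro conjI ballI allI)
  show "0 \<in> QV0" using BV_zero BV_QV0 by blast
next
  fix v w assume vw: "v \<in> QV0" "w \<in> QV0"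
  have "\<exists>z\<in>BV. qnorm (v + w - z) < e" if e: "0 < e" for e
  proof -
    obtain v' w' where v': "v' \<in> BV" "qnorm (v - v') < e/2" and w': "w' \<in> BV" "qnorm (w - w') < e/2"
      using QV0_approx vw half_gt_zero[OF e] by metis
    have "qnorm ((v - v') + (w - w')) < e"
      using QV_add(2)[of "v - v'" "w - w'"] QV_diff QV0_QV BV_QV vw v' w' by force
    then show ?thesis
      using BV_add[OF v'(1) w'(1)] by (intro bexI[of _ "v' + w'"]) (auto simp: algebra_simps)
  qed
  then show "v + w \<in> QV0" using vw QV_add unfolding QV0_def by blast
next
  fix c v assume v: "v \<in> QV0"
  have "\<exists>z\<in>BV. qnorm (c *\<^sub>R v - z) < e" if e: "0 < e" for e
  proof -
    have "0 < e / (\<bar>c\<bar> + 1)" using e by (simp add: add_nonneg_pos)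
    then obtain w where w: "w \<in> BV" "qnorm (v - w) < e / (\<bar>c\<bar> + 1)" using QV0_approx v by metis
    have "qnorm (c *\<^sub>R v - c *\<^sub>R w) = \<bar>c\<bar> * qnorm (v - w)"
      using QV_scaleR(2)[of "v - w" c] QV_diff(1) QV0_QV BV_QV v w by (simp add: scaleR_diff_right)
    also have "\<dots> \<le> (\<bar>c\<bar> + 1) * qnorm (v - w)" using qnorm_nonneg by (intro mult_right_mono) auto
    also have "\<dots> < e" using w by (simp add: field_simps add_nonneg_pos)
    finally show ?thesis using BV_scaleR w by blast
  qed
  then show "c *\<^sub>R v \<in> QV0" using v QV_scaleR unfolding QV0_def by blast
qed

lemma Metric_space_QV: "Metric_space QV (\<lambda>v w. qnorm (v - w))"
proof
  show "qnorm (x - y) = qnorm (y - x)" for x y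
    using qnorm_uminus[of "x - y"] by simp
  show "qnorm (x - y) = 0 \<longleftrightarrow> x = y" if "x \<in> QV" "y \<in> QV" for x y
    using qnorm_eq_0[of "x - y"] QV_diff(1) that by simp
  show "qnorm (x - z) \<le> qnorm (x - y) + qnorm (y - z)" if "x \<in> QV" "y \<in> QV" "z \<in> QV" for x y z
    using QV_add(2)[of "x - y" "y - z"] QV_diff(1) that by simp
qed (rule qnorm_nonneg)

lemma Metric_space_QV0: "Metric_space QV0 (\<lambda>v w. qnorm (v - w))"
  using Metric_space.subspace[OF Metric_space_QV] QV0_QV by blast

text \<open>The seminorms whose supremum is the norm pass to pointwise limits.\<close>

lemma mcomplete_QV0: "Metric_space.mcomplete QV0 (\<lambda>v w. qnorm (v - w))"
proof -
  interpret M: Metric_space QV0 "\<lambda>v w. qnorm (v - w)" by (rule Metric_space_QV0)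
  have "\<exists>l. limitin M.mtopology f l sequentially" if f: "M.MCauchy f" for f
  proof -
    have fV: "f n \<in> QV0" for n using f unfolding M.MCauchy_def by auto
    then have fQ: "f n \<in> QV" for n using QV0_QV by blast
    have cau: "\<exists>N. \<forall>m n. N \<le> m \<longrightarrow> N \<le> n \<longrightarrow> qnorm (f m - f n) < e" if "0 < e" for e
      using f that unfolding M.MCauchy_def by blast
    have ptw: "\<bar>f m x - f n x\<bar> \<le> qnorm (f m - f n)" for m n x
      using abs_le_qnorm[of "f m - f n" x] QV_diff(1) fQ by (simp add: fun_diff_def)
    have "Cauchy (\<lambda>n. f n x)" for x
      unfolding Cauchy_def dist_real_def using cau ptw by (meson le_less_trans)
    then have "\<exists>l. (\<lambda>n. f n x) \<longlonglongrightarrow> l" for x using Cauchy_convergent convergentD by blast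
    then obtain l where l: "\<And>x. (\<lambda>n. f n x) \<longlonglongrightarrow> l x" by metis
    have lim: "\<bar>(f m - l) x\<bar> + osc (f m - l) P \<le> e"
      if N: "\<forall>m n. N \<le> m \<longrightarrow> N \<le> n \<longrightarrow> qnorm (f m - f n) < e" and m: "N \<le> m" and P: "admissible P"
      for N e m x P
    proof (rule tendsto_upperbound[OF _ _ sequentially_bot])
      show "(\<lambda>n. \<bar>(f m - f n) x\<bar> + osc (f m - f n) P) \<longlonglongrightarrow> \<bar>(f m - l) x\<bar> + osc (f m - l) P"
        unfolding osc_def L2_set_def fun_diff_def by (intro tendsto_intros l)
      show "\<forall>\<^sub>F n in sequentially. \<bar>(f m - f n) x\<bar> + osc (f m - f n) P \<le> e"
        using eventually_ge_at_top[of N]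
      proof eventually_elim
        case (elim n)
        then show ?case
          using qnorm_upper[OF QV_diff(1)[OF fQ fQ] P, of m n x] N m by fastforce
      qed
    qed
    have out: "(f m - l) x = 0" if "x \<notin> topspace S" for x m
      using LIMSEQ_unique[OF l[of x]] QV_outside[OF fQ that] by (simp add: fun_diff_def)
    obtain N1 where N1: "\<forall>m n. N1 \<le> m \<longrightarrow> N1 \<le> n \<longrightarrow> qnorm (f m - f n) < 1"
      using cau[of 1] by auto
    \<comment> \<open>The estimates so far concern differences only; \<open>l\<close> enters
      \<open>QV\<close> as \<open>f N1 - (f N1 - l)\<close>.\<close>
    have d1: "f N1 - l \<in> QV"
      by (rule QV_I[OF out lim[OF N1]]) auto
    have lQ: "l \<in> QV" using QV_diff(1)[OF fQ d1, of N1] by simp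
    have conv: "\<exists>N. \<forall>n\<ge>N. qnorm (f n - l) < e" if e: "0 < e" for e
    proof -
      obtain N where N: "\<forall>m n. N \<le> m \<longrightarrow> N \<le> n \<longrightarrow> qnorm (f m - f n) < e/2"
        using cau[of "e/2"] e by auto
      have "qnorm (f n - l) \<le> e/2" if "n \<ge> N" for n
        by (rule qnorm_least[OF QV_diff(1)[OF fQ lQ] lim[OF N that]])
      then show ?thesis using e by (intro exI[of _ N]) fastforce
    qed
    have "\<exists>w\<in>BV. qnorm (l - w) < e" if e: "0 < e" for e
    proof -
      obtain N where N: "\<forall>n\<ge>N. qnorm (f n - l) < e/2" using conv[of "e/2"] e by auto
      obtain w where w: "w \<in> BV" "qnorm (f N - w) < e/2" using QV0_approx[OF fV, of "e/2" N] e by auto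
      have "qnorm (l - w) \<le> qnorm (l - f N) + qnorm (f N - w)"
        using Metric_space.triangle[OF Metric_space_QV] lQ fQ BV_QV w by blast
      moreover have "qnorm (l - f N) < e/2" using N M.commute by simp
      ultimately show ?thesis using w by (intro bexI[of _ w]) auto
    qed
    then have "l \<in> QV0" using lQ unfolding QV0_def by blast
    then show ?thesis using conv fV by (auto simp: M.limit_metric_sequentially)
  qed
  then show ?thesis unfolding M.mcomplete_def by blast
qed

lemma banach_on_QV0: "banach_on QV0 qnorm"
  using subspace_QV0 qnorm_eq_0 QV_add QV_scaleR QV0_QV mcomplete_QV0 by unfold_locales auto

lemma QV0_continuous:
  assumes "v \<in> QV0"
  shows "continuous_map S euclideanreal v"
proof -
  have "\<exists>w. w \<in> BV \<and> qnorm (v - w) < inverse (Suc n)" for n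
    using QV0_approx[OF assms, of "inverse (Suc n)"] by auto
  then obtain w where w: "\<And>n. w n \<in> BV" "\<And>n. qnorm (v - w n) < inverse (Suc n)" by metis
  have "continuous_map S Met_TC.mtopology v"
  proof (rule Met_TC.continuous_map_uniform_limit[where f = w and F = sequentially])
    show "\<forall>\<^sub>F n in sequentially. continuous_map S Met_TC.mtopology (w n)"
      using w(1) unfolding BV_def by (simp add: mtopology_is_euclidean)
    fix e :: real assume e: "0 < e"
    obtain N where N: "inverse (Suc N) < e" using reals_Archimedean[OF e] by auto
    show "\<forall>\<^sub>F n in sequentially. \<forall>x\<in>topspace S. v x \<in> UNIV \<and> dist (w n x) (v x) < e"
      using eventually_ge_at_top[of N]
    proof eventually_elim
      case (elim n)
      have "dist (w n x) (v x) < e" for x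
      proof -
        have "dist (w n x) (v x) \<le> qnorm (v - w n)"
          using abs_le_qnorm[of "v - w n" x] QV_diff(1) QV0_QV[OF assms] BV_QV[OF w(1)]
          by (simp add: dist_real_def fun_diff_def abs_minus_commute)
        also have "\<dots> < inverse (Suc n)" by (rule w(2))
        also have "\<dots> \<le> inverse (Suc N)" using elim by (simp add: field_simps)
        finally show ?thesis using N by simp
      qed
      then show ?case by simp
    qed
  qed simp
  then show ?thesis by (simp add: mtopology_is_euclidean)
qed

lemma BV_separation:
  assumes "u \<in> topspace S" "v \<in> topspace S" "u \<noteq> v"
  shows "\<exists>w\<in>BV. w u \<noteq> w v"
proof -
  obtain f where f: "continuous_map S euclideanreal f" "\<And>x. 0 \<le> f x \<and> f x \<le> 1"
    "\<And>t. {x \<in> topspace S. t < f x} \<in> HS" "f u \<noteq> f v"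
    using separation[OF assms] by blast
  define w where "w x = (if x \<in> topspace S then f x else 0)" for x
  have "(\<Sum>p\<in>P. \<bar>w (fst p) - w (snd p)\<bar>) \<le> 1" if P: "admissible P" for P
  proof -
    have "(\<Sum>p\<in>P. \<bar>w (fst p) - w (snd p)\<bar>) = (\<Sum>p\<in>P. \<bar>f (fst p) - f (snd p)\<bar>)"
      using P unfolding admissible_def w_def by (intro sum.cong) auto
    then show ?thesis using monotone_variation[OF f(2,3) P] by simp
  qed
  moreover have "continuous_map S euclideanreal w"
    by (rule continuous_map_eq[OF f(1)]) (simp add: w_def)
  moreover have "\<bar>w x\<bar> \<le> 1" for x using f(2)[of x] by (simp add: w_def)
  moreover have "w x = 0" if "x \<notin> topspace S" for x using that by (simp add: w_def)
  ultimately have "w \<in> BV" unfolding BV_def by blast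
  moreover have "w u \<noteq> w v" using f(4) assms by (simp add: w_def)
  ultimately show ?thesis by blast
qed

end

section \<open>No copy of l1\<close>

lemma cosh_le_exp_square:
  fixes y :: real
  assumes "0 \<le> y" "y \<le> 1"
  shows "cosh y \<le> exp (y\<^sup>2)"
proof -
  \<comment> \<open>The product equals \<open>1 + y^3\<close>. The resulting bound on
    \<open>exp (- y)\<close> mirrors the one on \<open>exp y\<close>, so that linear terms cancel in
    the average.\<close>
  have "1 \<le> (1 - y + y\<^sup>2) * (1 + y)"
    using assms by (simp add: algebra_simps power2_eq_square)
  also have "\<dots> \<le> (1 - y + y\<^sup>2) * exp y"
    using assms by (intro mult_left_mono) auto
  finally have "exp (- y) \<le> 1 - y + y\<^sup>2" by (simp add: exp_minus field_simps)
  moreover have "exp y \<le> 1 + y + y\<^sup>2" using exp_bound assms by blast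
  ultimately have "cosh y \<le> 1 + y\<^sup>2" by (simp add: cosh_field_def)
  also have "\<dots> \<le> exp (y\<^sup>2)" by simp
  finally show ?thesis .
qed

text \<open>Averaging over the sign of a new summand multiplies the potential by at most cosh (l C), so some
  choice of the sign does no worse.\<close>

lemma sign_choice_potential:
  fixes b :: "'i \<Rightarrow> 'x \<Rightarrow> real"
  assumes "finite A" "\<And>k x. \<lbrakk>k \<in> A; x \<in> F\<rbrakk> \<Longrightarrow> \<bar>b k x\<bar> \<le> C" "0 \<le> l" "0 \<le> C"
  shows "\<exists>s. (\<forall>k. \<bar>s k\<bar> = 1) \<and>
    (\<Sum>x\<in>F. cosh (l * (\<Sum>k\<in>A. s k * b k x))) \<le> real (card F) * cosh (l * C) ^ card A"
  using assms(1,2)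
proof (induction A)
  case empty
  then show ?case by (intro exI[of _ "\<lambda>_. 1"]) simp
next
  case (insert j A)
  then obtain s where s: "\<And>k. \<bar>s k\<bar> = 1"
    and le: "(\<Sum>x\<in>F. cosh (l * (\<Sum>k\<in>A. s k * b k x))) \<le> real (card F) * cosh (l * C) ^ card A"
    by auto
  define T where "T x = (\<Sum>k\<in>A. s k * b k x)" for x
  define G where "G e = (\<Sum>x\<in>F. cosh (l * (T x + e * b j x)))" for e
  have "G 1 + G (-1) = (\<Sum>x\<in>F. 2 * cosh (l * T x) * cosh (l * b j x))"
    unfolding G_def sum.distrib[symmetric]
    by (intro sum.cong refl) (simp add: algebra_simps cosh_add cosh_diff)
  also have "\<dots> \<le> (\<Sum>x\<in>F. 2 * cosh (l * T x) * cosh (l * C))"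
  proof (intro sum_mono mult_left_mono)
    fix x assume "x \<in> F"
    then have "\<bar>b j x\<bar> \<le> C" using insert.prems by blast
    then have "l * \<bar>b j x\<bar> \<le> l * C" using assms(3) by (rule mult_left_mono)
    then have "cosh (l * \<bar>b j x\<bar>) \<le> cosh (l * C)"
      using assms(3,4) by (subst cosh_real_nonneg_le_iff) auto
    then show "cosh (l * b j x) \<le> cosh (l * C)"
      by (metis abs_mult abs_of_nonneg assms(3) cosh_real_abs)
  qed auto
  also have "\<dots> = 2 * cosh (l * C) * (\<Sum>x\<in>F. cosh (l * T x))"
    by (simp add: sum_distrib_left mult_ac)
  also have "\<dots> \<le> 2 * cosh (l * C) * (real (card F) * cosh (l * C) ^ card A)"
    using le unfolding T_def by (intro mult_left_mono) auto
  also have "\<dots> = 2 * (real (card F) * cosh (l * C) ^ card (insert j A))"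
    using insert.hyps by simp
  finally have "\<exists>e. \<bar>e\<bar> = 1 \<and> G e \<le> real (card F) * cosh (l * C) ^ card (insert j A)"
    by (smt (verit))
  then obtain e where e: "\<bar>e\<bar> = 1" "G e \<le> real (card F) * cosh (l * C) ^ card (insert j A)"
    by blast
  have "(\<Sum>k\<in>insert j A. (s(j := e)) k * b k x) = T x + e * b j x" for x
  proof -
    have "(\<Sum>k\<in>A. (s(j := e)) k * b k x) = T x"
      unfolding T_def using insert.hyps by (intro sum.cong) auto
    then show ?thesis using insert.hyps by simp
  qed
  then have "(\<Sum>x\<in>F. cosh (l * (\<Sum>k\<in>insert j A. (s(j := e)) k * b k x))) = G e"
    unfolding G_def by simp
  then show ?case using e s by (intro exI[of _ "s(j := e)"]) auto
qed

text \<open>Hoeffding's inequality with a union bound over \<open>F\<close>, without probability: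
  each summand of the potential dominates half the exponential of \<open>l\<close> times the signed
  sum's modulus at that point, so one bound on the potential serves all points.\<close>

lemma sign_choice:
  fixes b :: "'i \<Rightarrow> 'x \<Rightarrow> real"
  assumes A: "finite A" and F: "finite F" and b: "\<And>k x. \<lbrakk>k \<in> A; x \<in> F\<rbrakk> \<Longrightarrow> \<bar>b k x\<bar> \<le> C"
    and C: "1 \<le> C" and e: "0 < e" "e \<le> 1"
    and big: "2 * real (card F) \<le> exp (e\<^sup>2 / (4 * C\<^sup>2) * real (card A))"
  shows "\<exists>s. (\<forall>k. \<bar>s k\<bar> = 1) \<and> (\<forall>x\<in>F. \<bar>\<Sum>k\<in>A. s k * b k x\<bar> \<le> e * card A)"
proof -
  \<comment> \<open>This \<open>l\<close> maximises \<open>l * e - l^2 * C^2\<close>, and the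
    maximum \<open>e^2 / (4 * C^2)\<close> is the rate in \<open>big\<close>.\<close>
  define l where "l = e / (2 * C\<^sup>2)"
  have l: "0 < l" using e C by (simp add: l_def)
  have "l * C = e / (2 * C)" using C by (simp add: l_def power2_eq_square)
  also have "\<dots> \<le> 1" using e C by (simp add: field_simps)
  finally have lC: "l * C \<le> 1" .
  have "(l * C)\<^sup>2 = l * e / 2" using C by (simp add: l_def power2_eq_square field_simps)
  then have cosh_le: "cosh (l * C) \<le> exp (l * e / 2)"
    using cosh_le_exp_square[of "l * C"] lC mult_nonneg_nonneg[of l C] l C by (simp only: less_imp_le)
  have half: "l * e / 2 = e\<^sup>2 / (4 * C\<^sup>2)" by (simp add: l_def power2_eq_square)
  obtain s where s: "\<And>k. \<bar>s k\<bar> = 1"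
    and le: "(\<Sum>x\<in>F. cosh (l * (\<Sum>k\<in>A. s k * b k x))) \<le> real (card F) * cosh (l * C) ^ card A"
    using sign_choice_potential[where b = b and l = l, OF A b] l C by force
  have "\<bar>\<Sum>k\<in>A. s k * b k x\<bar> \<le> e * card A" if x: "x \<in> F" for x
  proof -
    let ?T = "\<Sum>k\<in>A. s k * b k x"
    let ?E = "exp (l * e / 2 * card A)"
    have "exp (l * \<bar>?T\<bar>) \<le> 2 * cosh (l * \<bar>?T\<bar>)" by (simp add: cosh_field_def)
    also have "cosh (l * \<bar>?T\<bar>) = cosh (l * ?T)"
      using cosh_real_abs[of "l * ?T"] l by (simp add: abs_mult)
    also have "cosh (l * ?T) \<le> (\<Sum>x\<in>F. cosh (l * (\<Sum>k\<in>A. s k * b k x)))"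
      by (rule member_le_sum[OF x _ F]) simp
    also have "\<dots> \<le> real (card F) * ?E"
    proof (rule order_trans[OF le])
      have "cosh (l * C) ^ card A \<le> exp (l * e / 2) ^ card A"
        using cosh_le by (intro power_mono) auto
      also have "\<dots> = ?E" by (simp add: exp_of_nat_mult[symmetric] mult.commute)
      finally show "real (card F) * cosh (l * C) ^ card A \<le> real (card F) * ?E"
        by (intro mult_left_mono) auto
    qed
    also have "2 * (real (card F) * ?E) \<le> ?E * ?E"
      using mult_right_mono[OF big, of ?E] unfolding half by (simp add: mult_ac)
    also have "\<dots> = exp (l * (e * card A))" by (simp flip: exp_add)
    finally show ?thesis using l by simp
  qed
  then show ?thesis using s by blast
qed

lemma sum_fun_apply: "(\<Sum>i\<in>I. f i) x = (\<Sum>i\<in>I. f i x :: real)"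
  by (induction I rule: infinite_finite_induct) (auto simp: zero_fun_def)

section \<open>Linearly many distinguishable points, and the blocks built from this\<close>

context nested_halfspaces
begin

text \<open>Squared differences over an admissible pairing of \<open>F\<close> are counted in two
  ways: every pair receives at least \<open>e^2\<close> from some \<open>k\<close>, and every
  \<open>k\<close> contributes at most \<open>C^2\<close>. The factor 2 and the 1 account for
  \<open>card F div 2\<close>.\<close>

lemma separated_card:
  assumes F: "finite F" "F \<subseteq> topspace S" and A: "finite A" and e: "0 < e"
    and f: "\<And>k. k \<in> A \<Longrightarrow> f k \<in> QV" "\<And>k. k \<in> A \<Longrightarrow> qnorm (f k) \<le> C"
    and sep: "\<And>x y. \<lbrakk>x \<in> F; y \<in> F; x \<noteq> y\<rbrakk> \<Longrightarrow> \<exists>k\<in>A. e \<le> \<bar>f k x - f k y\<bar>"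
  shows "real (card F) \<le> 2 * C\<^sup>2 / e\<^sup>2 * card A + 1"
proof -
  obtain P where P: "admissible P" "P \<subseteq> F \<times> F" "\<forall>(a, b)\<in>P. a \<noteq> b" "card P = card F div 2"
    using admissible_pairing[OF F] by blast
  have "e\<^sup>2 \<le> (\<Sum>k\<in>A. (f k (fst p) - f k (snd p))\<^sup>2)" if p: "p \<in> P" for p
  proof -
    obtain k where k: "k \<in> A" "e \<le> \<bar>f k (fst p) - f k (snd p)\<bar>"
    proof -
      have "fst p \<in> F" "snd p \<in> F" "fst p \<noteq> snd p" using p P(2,3) by auto
      then show ?thesis using sep that by blast
    qed
    then have "e\<^sup>2 \<le> (f k (fst p) - f k (snd p))\<^sup>2"
      using power_mono[OF k(2), of 2] e by simp
    also have "\<dots> \<le> (\<Sum>k\<in>A. (f k (fst p) - f k (snd p))\<^sup>2)"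
      by (rule member_le_sum[OF k(1) _ A]) simp
    finally show ?thesis .
  qed
  then have "real (card P) * e\<^sup>2 \<le> (\<Sum>p\<in>P. \<Sum>k\<in>A. (f k (fst p) - f k (snd p))\<^sup>2)"
    using sum_mono[of P "\<lambda>_. e\<^sup>2"] by simp
  also have "\<dots> = (\<Sum>k\<in>A. (osc (f k) P)\<^sup>2)"
    by (subst sum.swap) (simp add: osc_def L2_set_def sum_nonneg)
  also have "\<dots> \<le> (\<Sum>k\<in>A. C\<^sup>2)"
  proof (intro sum_mono power_mono osc_nonneg)
    show "osc (f k) P \<le> C" if "k \<in> A" for k
      using osc_le_qnorm[OF f(1)[OF that] P(1)] f(2)[OF that] by linarith
  qed
  finally have "real (card F div 2) * e\<^sup>2 \<le> card A * C\<^sup>2" by (simp add: P)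
  then have "real (card F div 2) \<le> C\<^sup>2 / e\<^sup>2 * card A" using e by (simp add: field_simps)
  moreover have "real (card F) \<le> 2 * real (card F div 2) + 1"
    by linarith
  ultimately show ?thesis by simp
qed

text \<open>A separated set of largest size exists by \<open>separated_card\<close>, and being
  maximal it is a net.\<close>

lemma separated_net:
  assumes A: "finite A" and e: "0 < e"
    and f: "\<And>k. k \<in> A \<Longrightarrow> f k \<in> QV" "\<And>k. k \<in> A \<Longrightarrow> qnorm (f k) \<le> C"
  obtains F where "finite F" "F \<subseteq> topspace S" "real (card F) \<le> 2 * C\<^sup>2 / e\<^sup>2 * card A + 1"
    "\<And>x. x \<in> topspace S \<Longrightarrow> \<exists>y\<in>F. \<forall>k\<in>A. \<bar>f k x - f k y\<bar> < e"
proof -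
  define Q where "Q F \<longleftrightarrow> finite F \<and> F \<subseteq> topspace S \<and>
    (\<forall>x\<in>F. \<forall>y\<in>F. x \<noteq> y \<longrightarrow> (\<exists>k\<in>A. e \<le> \<bar>f k x - f k y\<bar>))" for F
  have card_le: "real (card F) \<le> 2 * C\<^sup>2 / e\<^sup>2 * card A + 1" if "Q F" for F
    using separated_card[of F A e f C] that A e f unfolding Q_def by blast
  have "card F < nat \<lceil>2 * C\<^sup>2 / e\<^sup>2 * card A + 1\<rceil> + 1" if "Q F" for F
    using card_le[OF that] by linarith
  moreover have "Q {}" by (simp add: Q_def)
  ultimately obtain F where F: "Q F" and max: "\<And>F'. Q F' \<Longrightarrow> card F' \<le> card F"
    using ex_has_greatest_nat[of Q "{}" card] by blast
  have "\<exists>y\<in>F. \<forall>k\<in>A. \<bar>f k x - f k y\<bar> < e" if x: "x \<in> topspace S" for x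
  proof (rule ccontr)
    assume "\<not> ?thesis"
    then have far: "\<exists>k\<in>A. e \<le> \<bar>f k x - f k y\<bar>" if "y \<in> F" for y using that by force
    then have "x \<notin> F" using e by force
    moreover have "Q (insert x F)"
      using F far x unfolding Q_def by (auto simp: abs_minus_commute)
    ultimately show False using max[of "insert x F"] F unfolding Q_def by simp
  qed
  moreover have "finite F" "F \<subseteq> topspace S" using F unfolding Q_def by auto
  ultimately show ?thesis using card_le[OF F] that by presburger
qed

text \<open>The net for \<open>n\<close> functions has size linear in \<open>n\<close>, while
  \<open>sign_choice\<close> tolerates exponentially many points. The bound \<open>m\<close> lets
  the caller avoid indices already used.\<close>

lemma small_signed_average:
  assumes f: "\<And>k. f k \<in> QV" "\<And>k. qnorm (f k) \<le> C" and C: "1 \<le> C" and e: "0 < e" "e \<le> 1"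
  shows "\<exists>A a. finite A \<and> A \<subseteq> {m::nat..} \<and> (\<Sum>k\<in>A. \<bar>a k\<bar>) = 1 \<and>
    (\<forall>x. \<bar>\<Sum>k\<in>A. a k * f k x\<bar> \<le> e)"
proof -
  \<comment> \<open>One half of \<open>e\<close> is spent at net points, the other on passing from
    any point to a net point close to it.\<close>
  define d where "d = e / 2"
  have d: "0 < d" "d \<le> 1" using e by (auto simp: d_def)
  define K where "K = 2 * C\<^sup>2 / d\<^sup>2 + 1"
  define r where "r = d\<^sup>2 / (4 * C\<^sup>2)"
  have K: "1 \<le> K" using C d by (simp add: K_def)
  have r: "0 < r" using d C by (simp add: r_def)
  \<comment> \<open>Large enough for \<open>2 * (K * n) \<le> (r * n / 2)^2\<close>, which is below
    \<open>exp (r * n)\<close>; \<open>K * n\<close> absorbs the additive 1 of the net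
    bound.\<close>
  obtain n where n: "8 * K / r\<^sup>2 < real n" using reals_Archimedean2 by blast
  have n0: "1 \<le> n" using n K r by (cases n) (auto simp: field_simps)
  have "2 * (K * n) \<le> (r * n / 2)\<^sup>2"
    using n n0 r by (simp add: field_simps power2_eq_square)
  also have "\<dots> \<le> (exp (r * n / 2))\<^sup>2"
  proof (intro power_mono)
    show "r * n / 2 \<le> exp (r * n / 2)" using exp_ge_add_one_self[of "r * n / 2"] by linarith
  qed (use r in simp)
  also have "\<dots> = exp (r * n)" by (simp add: power2_eq_square flip: exp_add)
  finally have exp_big: "2 * (K * n) \<le> exp (r * n)" .
  define A where "A = {m..<m+n}"
  have A: "finite A" "card A = n" by (auto simp: A_def)
  obtain F where F: "finite F" "F \<subseteq> topspace S" "real (card F) \<le> 2 * C\<^sup>2 / d\<^sup>2 * card A + 1"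
    and net: "\<And>x. x \<in> topspace S \<Longrightarrow> \<exists>y\<in>F. \<forall>k\<in>A. \<bar>f k x - f k y\<bar> < d"
    using separated_net[where f = f, OF A(1) d(1) f] by blast
  have "real (card F) \<le> K * n" using F(3) n0 A by (simp add: K_def algebra_simps)
  then have big: "2 * real (card F) \<le> exp (r * real (card A))" using exp_big A by simp
  have fC: "\<bar>f k x\<bar> \<le> C" for k x using abs_le_qnorm[OF f(1)] f(2) order_trans by blast
  obtain s where s: "\<And>k. \<bar>s k\<bar> = 1" and sF: "\<And>x. x \<in> F \<Longrightarrow> \<bar>\<Sum>k\<in>A. s k * f k x\<bar> \<le> d * card A"
    using sign_choice[where b = f, OF A(1) F(1) fC C d] big unfolding r_def by blast
  have sX: "\<bar>\<Sum>k\<in>A. s k * f k x\<bar> \<le> e * n" for x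
  proof (cases "x \<in> topspace S")
    case True
    then obtain y where y: "y \<in> F" "\<And>k. k \<in> A \<Longrightarrow> \<bar>f k x - f k y\<bar> < d" using net by blast
    have "\<bar>(\<Sum>k\<in>A. s k * f k x) - (\<Sum>k\<in>A. s k * f k y)\<bar> \<le> (\<Sum>k\<in>A. \<bar>s k * (f k x - f k y)\<bar>)"
      by (simp add: algebra_simps flip: sum_subtractf)
    also have "\<dots> \<le> (\<Sum>k\<in>A. d)"
      using y(2) by (intro sum_mono) (auto simp: abs_mult s intro: less_imp_le)
    finally have "\<bar>(\<Sum>k\<in>A. s k * f k x) - (\<Sum>k\<in>A. s k * f k y)\<bar> \<le> n * d" using A by simp
    moreover have "n * d + d * n = e * n" by (simp add: d_def)
    moreover have "\<bar>\<Sum>k\<in>A. s k * f k y\<bar> \<le> d * n" using sF[OF y(1)] A by simp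
    ultimately show ?thesis by linarith
  next
    case False
    then have "f k x = 0" for k using QV_outside f(1) by blast
    then show ?thesis using e by simp
  qed
  have "(\<Sum>k\<in>A. \<bar>s k / n\<bar>) = 1" using n0 A by (simp add: s)
  moreover have "\<bar>\<Sum>k\<in>A. s k / n * f k x\<bar> \<le> e" for x
  proof -
    have "(\<Sum>k\<in>A. s k / n * f k x) = (\<Sum>k\<in>A. s k * f k x) / n"
      by (simp add: sum_divide_distrib)
    then have "\<bar>\<Sum>k\<in>A. s k / n * f k x\<bar> = \<bar>\<Sum>k\<in>A. s k * f k x\<bar> / n" by simp
    also have "\<dots> \<le> e" using sX[of x] n0 by (simp add: pos_divide_le_eq)
    finally show ?thesis .
  qed
  moreover have "A \<subseteq> {m..}" by (auto simp: A_def)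
  ultimately show ?thesis
    using A(1) by (intro exI[of _ A] exI[of _ "\<lambda>k. s k / n"] conjI allI)
qed

text \<open>The cross term pairs the total variation of \<open>w\<close> with increments of
  \<open>w'\<close>, which are at most \<open>2 * d\<close>: a uniformly tiny \<open>w'\<close> is
  almost orthogonal to \<open>w\<close>.\<close>

lemma osc_add_square:
  assumes w: "\<And>x. \<bar>w' x\<bar> \<le> d" and B: "(\<Sum>p\<in>P. \<bar>w (fst p) - w (snd p)\<bar>) \<le> B"
  shows "(osc (w + w') P)\<^sup>2 \<le> (osc w P)\<^sup>2 + (osc w' P)\<^sup>2 + 4 * d * B"
proof -
  let ?D = "\<lambda>w p. w (fst p) - w (snd p)"
  have d: "0 \<le> d" using order_trans[OF abs_ge_zero w] .
  have "(\<Sum>p\<in>P. (?D (w + w') p)\<^sup>2) = (\<Sum>p\<in>P. (?D w p)\<^sup>2 + (?D w' p)\<^sup>2 + 2 * (?D w p * ?D w' p))"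
    by (intro sum.cong refl) (simp add: plus_fun_def power2_eq_square algebra_simps)
  also have "\<dots> \<le> (\<Sum>p\<in>P. (?D w p)\<^sup>2 + (?D w' p)\<^sup>2 + 4 * d * \<bar>?D w p\<bar>)"
  proof (intro sum_mono add_left_mono)
    fix p
    have "\<bar>?D w' p\<bar> \<le> 2 * d" using w[of "fst p"] w[of "snd p"] by linarith
    then have "\<bar>?D w p\<bar> * \<bar>?D w' p\<bar> \<le> \<bar>?D w p\<bar> * (2 * d)" by (intro mult_left_mono) auto
    moreover have "?D w p * ?D w' p \<le> \<bar>?D w p\<bar> * \<bar>?D w' p\<bar>" by (metis abs_ge_self abs_mult)
    ultimately show "2 * (?D w p * ?D w' p) \<le> 4 * d * \<bar>?D w p\<bar>" by (simp add: mult_ac)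
  qed
  also have "\<dots> = (\<Sum>p\<in>P. (?D w p)\<^sup>2) + (\<Sum>p\<in>P. (?D w' p)\<^sup>2) + 4 * d * (\<Sum>p\<in>P. \<bar>?D w p\<bar>)"
    by (simp add: sum.distrib sum_distrib_left)
  also have "\<dots> \<le> (\<Sum>p\<in>P. (?D w p)\<^sup>2) + (\<Sum>p\<in>P. (?D w' p)\<^sup>2) + 4 * d * B"
    using B d by (intro add_left_mono mult_left_mono) auto
  finally show ?thesis by (simp add: osc_def L2_set_def sum_nonneg)
qed

text \<open>Blocks of small supremum norm, perturbed into BV, almost satisfy an upper 2-estimate: by
  osc_add_square a new block that is uniformly small relative to the variation of the old sum
  contributes a negligible cross term.\<close>

lemma block_sequence:
  assumes f: "\<And>k. f k \<in> QV0" "\<And>k. qnorm (f k) \<le> C" and C: "1 \<le> C" and e: "0 < e" "e \<le> 1"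
  shows "\<exists>A a w. finite (A :: nat set) \<and> w \<in> BV \<and> (\<Sum>k\<in>A. \<bar>a k\<bar>) = real n \<and>
    qnorm ((\<Sum>k\<in>A. a k *\<^sub>R f k) - w) \<le> n * e \<and> (\<forall>x. \<bar>w x\<bar> \<le> n * e) \<and>
    (\<forall>P. admissible P \<longrightarrow> (osc w P)\<^sup>2 \<le> n * ((C + 1)\<^sup>2 + 1))"
proof (induction n)
  case 0
  show ?case
    using BV_zero qnorm_zero osc_zero
    by (intro exI[of _ "{}"] exI[of _ "\<lambda>_. 0"] exI[of _ 0]) (simp add: zero_fun_def)
next
  case (Suc n)
  then obtain A a w where IH: "finite (A :: nat set) \<and> w \<in> BV \<and> (\<Sum>k\<in>A. \<bar>a k\<bar>) = real n \<and>
    qnorm ((\<Sum>k\<in>A. a k *\<^sub>R f k) - w) \<le> n * e \<and> (\<forall>x. \<bar>w x\<bar> \<le> n * e) \<and>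
    (\<forall>P. admissible P \<longrightarrow> (osc w P)\<^sup>2 \<le> n * ((C + 1)\<^sup>2 + 1))"
    by (elim exE) (rule that)
  then have A: "finite A" and w: "w \<in> BV" and a: "(\<Sum>k\<in>A. \<bar>a k\<bar>) = real n"
    and approx: "qnorm ((\<Sum>k\<in>A. a k *\<^sub>R f k) - w) \<le> n * e"
    by blast+
  have small: "\<bar>w x\<bar> \<le> n * e" for x using IH by blast
  have osc_w: "(osc w P)\<^sup>2 \<le> n * ((C + 1)\<^sup>2 + 1)" if "admissible P" for P using IH that by blast
  have fQ: "f k \<in> QV" for k using QV0_QV f by blast
  obtain B where B: "\<And>P. admissible P \<Longrightarrow> (\<Sum>p\<in>P. \<bar>w (fst p) - w (snd p)\<bar>) \<le> B"
    using w unfolding BV_def by blast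
  have B0: "0 \<le> B" using B[OF admissible_empty] by simp
  \<comment> \<open>The second bound gives \<open>4 * d * B \<le> 1\<close>, so the cross term fits
    into the summand 1 of \<open>(C + 1)^2 + 1\<close>; the square there bounds the new block
    itself.\<close>
  define d where "d = min e (1 / (4 * (B + 1)))"
  have d: "0 < d" "d \<le> e" using e B0 by (auto simp: d_def)
  have "d \<le> 1 / (4 * (B + 1))" by (simp add: d_def)
  then have dB: "4 * d * B \<le> 1" using B0 d by (simp add: field_simps)
  obtain m where m: "A \<subseteq> {..<m}" using finite_nat_iff_bounded A by blast
  \<comment> \<open>One half of \<open>d\<close> bounds the new average uniformly, the other is the
    error of replacing it by a function of bounded variation.\<close>
  have d2: "0 < d / 2" "d / 2 \<le> 1" using d e by auto
  obtain A' a' where block: "finite A' \<and> A' \<subseteq> {m..} \<and> (\<Sum>k\<in>A'. \<bar>a' k\<bar>) = 1 \<and>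
    (\<forall>x. \<bar>\<Sum>k\<in>A'. a' k * f k x\<bar> \<le> d / 2)"
    using small_signed_average[where f = f and m = m, OF fQ f(2) C d2] by (elim exE) (rule that)
  then have A': "finite A'" "A' \<subseteq> {m..}" and a': "(\<Sum>k\<in>A'. \<bar>a' k\<bar>) = 1" by blast+
  have sup: "\<bar>\<Sum>k\<in>A'. a' k * f k x\<bar> \<le> d / 2" for x using block by blast
  define g where "g = (\<Sum>k\<in>A'. a' k *\<^sub>R f k)"
  have gV: "g \<in> QV0" unfolding g_def
    using subspace_QV0 f(1) by (intro subspace_sum subspace_scale)
  have g_sup: "\<bar>g x\<bar> \<le> d / 2" for x
    using sup[of x] by (simp add: g_def sum_fun_apply scaleR_fun_def)
  have "qnorm g \<le> (\<Sum>k\<in>A'. qnorm (a' k *\<^sub>R f k))"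
    unfolding g_def by (rule QV_sum(2)) (rule QV_scaleR(1)[OF fQ])
  also have "\<dots> \<le> (\<Sum>k\<in>A'. \<bar>a' k\<bar> * C)"
    using f(2) by (intro sum_mono) (simp add: QV_scaleR fQ mult_left_mono)
  also have "\<dots> = C" using a' by (simp flip: sum_distrib_right)
  finally have g_norm: "qnorm g \<le> C" .
  obtain w' where w': "w' \<in> BV" "qnorm (g - w') < d / 2"
    using QV0_approx[OF gV] d2(1) by blast
  have gQ: "g \<in> QV" "w' \<in> QV" "w \<in> QV" using QV0_QV gV BV_QV w' w by auto
  have w'_sup: "\<bar>w' x\<bar> \<le> d" for x
    using abs_le_qnorm[OF QV_diff(1)[OF gQ(1,2)], of x] w'(2) g_sup[of x]
    by (simp add: fun_diff_def)
  have "qnorm w' \<le> qnorm g + qnorm (g - w')"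
    using QV_diff(2)[OF gQ(1) QV_diff(1)[OF gQ(1,2)]] by simp
  then have w'_norm: "qnorm w' \<le> C + 1" using g_norm w'(2) d2(2) by linarith
  define a'' where "a'' k = (if k \<in> A then a k else a' k)" for k
  have disj: "A \<inter> A' = {}" using m A'(2) by (fastforce dest: subsetD)
  \<comment> \<open>Polymorphic in \<open>h\<close>, since it is applied to the vectors as well as
    to the moduli of the coefficients.\<close>
  have split: "(\<Sum>k\<in>A \<union> A'. h (a'' k) k) = (\<Sum>k\<in>A. h (a k) k) + (\<Sum>k\<in>A'. h (a' k) k)"
    for h :: "real \<Rightarrow> nat \<Rightarrow> 'z::comm_monoid_add"
    unfolding sum.union_disjoint[OF A A'(1) disj] a''_def using disj
    by (intro arg_cong2[of _ _ _ _ "(+)"] sum.cong) auto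
  have sums: "(\<Sum>k\<in>A \<union> A'. a'' k *\<^sub>R f k) - (w + w') = ((\<Sum>k\<in>A. a k *\<^sub>R f k) - w) + (g - w')"
    unfolding split[of "\<lambda>c k. c *\<^sub>R f k"] g_def by (simp add: algebra_simps)
  have sQ: "(\<Sum>k\<in>A. a k *\<^sub>R f k) - w \<in> QV"
    using QV_sum(1)[of A "\<lambda>k. a k *\<^sub>R f k"] QV_scaleR(1) fQ QV_diff(1) gQ by blast
  have "qnorm ((\<Sum>k\<in>A \<union> A'. a'' k *\<^sub>R f k) - (w + w')) \<le> Suc n * e"
    unfolding sums using QV_add(2)[OF sQ QV_diff(1)[OF gQ(1,2)]] approx w'(2) d
    by (simp add: algebra_simps)
  moreover have "\<bar>(w + w') x\<bar> \<le> Suc n * e" for x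
    using small[of x] w'_sup[of x] d by (simp add: plus_fun_def algebra_simps)
  moreover have "(osc (w + w') P)\<^sup>2 \<le> Suc n * ((C + 1)\<^sup>2 + 1)" if P: "admissible P" for P
  proof -
    have "(osc w' P)\<^sup>2 \<le> (C + 1)\<^sup>2"
      using osc_le_qnorm[OF gQ(2) P] w'_norm by (intro power_mono) auto
    then show ?thesis
      using osc_add_square[where w = w and w' = w', OF w'_sup B[OF P]] osc_w[OF P] dB by (simp add: algebra_simps)
  qed
  moreover have "(\<Sum>k\<in>A \<union> A'. \<bar>a'' k\<bar>) = Suc n"
    using split[of "\<lambda>c k. \<bar>c\<bar>"] a a' by simp
  moreover have "finite (A \<union> A')" "w + w' \<in> BV" using A A' BV_add[OF w w'(1)] by blast+
  ultimately show ?case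
    by (intro exI[of _ "A \<union> A'"] exI[of _ a''] exI[of _ "w + w'"] conjI allI impI)
qed

text \<open>A combination with coefficient mass \<open>n\<close> has norm at most
  \<open>2 * n * e + sqrt (n * K)\<close>, which is of smaller order than \<open>c * n\<close> up to
  the free choice of \<open>e\<close>.\<close>

lemma no_l1_sequence:
  assumes f: "\<And>k. f k \<in> QV0" "\<And>k::nat. qnorm (f k) \<le> C" and c: "0 < c"
  shows "\<exists>A a. finite A \<and> qnorm (\<Sum>k\<in>A. a k *\<^sub>R f k) < c * (\<Sum>k\<in>A. \<bar>a k\<bar>)"
proof -
  define C' where "C' = max C 1"
  have C': "1 \<le> C'" "\<And>k. qnorm (f k) \<le> C'" using f(2) by (auto simp: C'_def le_max_iff_disj)
  \<comment> \<open>\<open>2 * n * e\<close> takes at most half of \<open>c * n\<close>; the choice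
    of \<open>n\<close> below keeps \<open>sqrt (n * K)\<close> under the other half.\<close>
  define e where "e = min 1 (c / 4)"
  have e: "0 < e" "e \<le> 1" "4 * e \<le> c" using c by (auto simp: e_def)
  define K where "K = (C' + 1)\<^sup>2 + 1"
  obtain n where n: "4 * K / c\<^sup>2 < real n" using reals_Archimedean2 by blast
  have K: "0 < K" by (simp add: K_def add_nonneg_pos)
  then have n0: "0 < real n" using n c by (smt (verit) divide_pos_pos zero_less_power)
  obtain A a w where blocks: "finite (A :: nat set) \<and> w \<in> BV \<and> (\<Sum>k\<in>A. \<bar>a k\<bar>) = real n \<and>
    qnorm ((\<Sum>k\<in>A. a k *\<^sub>R f k) - w) \<le> n * e \<and> (\<forall>x. \<bar>w x\<bar> \<le> n * e) \<and>
    (\<forall>P. admissible P \<longrightarrow> (osc w P)\<^sup>2 \<le> n * K)"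
    using block_sequence[where f = f, OF f(1) C'(2,1) e(1,2), of n, folded K_def]
    by (elim exE) (rule that)
  then have A: "finite A" and w: "w \<in> BV" and a: "(\<Sum>k\<in>A. \<bar>a k\<bar>) = real n"
    and approx: "qnorm ((\<Sum>k\<in>A. a k *\<^sub>R f k) - w) \<le> n * e"
    by blast+
  have small: "\<bar>w x\<bar> \<le> n * e" for x using blocks by blast
  have osc_w: "(osc w P)\<^sup>2 \<le> n * K" if "admissible P" for P using blocks that by blast
  have wQ: "w \<in> QV" using BV_QV w by blast
  have sQ: "(\<Sum>k\<in>A. a k *\<^sub>R f k) \<in> QV"
    using QV_sum(1)[of A "\<lambda>k. a k *\<^sub>R f k"] QV_scaleR(1) f(1) QV0_QV by blast
  have "4 * K < c\<^sup>2 * n" using n c by (simp add: field_simps)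
  then have "n * K < (c * n / 2)\<^sup>2" using n0 by (simp add: power2_eq_square field_simps)
  then have sq: "sqrt (n * K) < c * n / 2"
    using c n0 K by (intro real_less_lsqrt) auto
  have "qnorm w \<le> n * e + sqrt (n * K)"
    using small osc_w by (intro qnorm_least[OF wQ] add_mono real_le_rsqrt)
  moreover have "qnorm (\<Sum>k\<in>A. a k *\<^sub>R f k) \<le> n * e + qnorm w"
    using QV_add(2)[OF QV_diff(1)[OF sQ wQ] wQ] approx by simp
  moreover have "n * (4 * e) \<le> n * c" using e n0 by (intro mult_left_mono) auto
  ultimately have "qnorm (\<Sum>k\<in>A. a k *\<^sub>R f k) < c * (\<Sum>k\<in>A. \<bar>a k\<bar>)"
    using sq a by (simp add: algebra_simps)
  then show ?thesis using A by (intro exI[of _ A] exI[of _ a] conjI)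
qed

lemma not_contains_l1: "\<not> contains_l1 QV0 qnorm"
proof
  assume "contains_l1 QV0 qnorm"
  then obtain J c C where J: "J \<in> l1_space \<rightarrow> QV0" "linear_map_on l1_space J" and c: "0 < c"
    and bd: "\<And>x. x \<in> l1_space \<Longrightarrow> c * l1_norm x \<le> qnorm (J x) \<and> qnorm (J x) \<le> C * l1_norm x"
    unfolding contains_l1_def by blast
  \<comment> \<open>Finitely supported sequences suffice for the contradiction;
    \<open>v {k} (\<lambda>_. 1)\<close> is the \<open>k\<close>-th unit vector.\<close>
  define v where "v A a = (\<lambda>i. if i \<in> A then a i else 0 :: real)" for A :: "nat set" and a
  have sums: "(\<lambda>n. \<bar>v A a n\<bar>) sums (\<Sum>k\<in>A. \<bar>a k\<bar>)" if "finite A" for A a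
    using sums_finite[OF that, of "\<lambda>n. \<bar>v A a n\<bar>"] by (simp add: v_def)
  have v_in: "v A a \<in> l1_space" and v_norm: "l1_norm (v A a) = (\<Sum>k\<in>A. \<bar>a k\<bar>)" if "finite A" for A a
    using sums[OF that] by (auto simp: l1_space_def l1_norm_def sums_iff)
  define f where "f k = J (v {k} (\<lambda>_. 1))" for k
  have fV: "f k \<in> QV0" for k using J(1) v_in unfolding f_def by blast
  have fC: "qnorm (f k) \<le> C" for k     using bd[OF v_in[of "{k}" "\<lambda>_. 1"]] v_norm[of "{k}" "\<lambda>_. 1"] by (simp add: f_def)
  have J_sum: "J (v A a) = (\<Sum>k\<in>A. a k *\<^sub>R f k)" if "finite A" for A a
    using that
  proof (induction A)
    case empty
    \<comment> \<open>\<open>linear_map_on\<close> speaks of sums and multiples only, so the value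
      at 0 comes from scaling by 0.\<close>
    have "v {} a = 0 *\<^sub>R v {} a" by (auto simp: v_def scaleR_fun_def)
    then have "J (v {} a) = 0 *\<^sub>R J (v {} a)"
      using J(2) v_in[of "{}" a] unfolding linear_map_on_def by (metis finite.emptyI)
    then show ?case by simp
  next
    case (insert k A)
    have "v (insert k A) a = a k *\<^sub>R v {k} (\<lambda>_. 1) + v A a"
      using insert.hyps by (auto simp: v_def scaleR_fun_def plus_fun_def fun_eq_iff)
    moreover have "a k *\<^sub>R v {k} (\<lambda>_. 1) = v {k} a"
      by (auto simp: v_def scaleR_fun_def)
    ultimately have "J (v (insert k A) a) = a k *\<^sub>R f k + J (v A a)"
      using J(2) v_in insert.hyps unfolding linear_map_on_def f_def
      by (metis finite.emptyI finite.insertI)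
    then show ?case using insert by simp
  qed
  obtain A a where "finite A" "qnorm (\<Sum>k\<in>A. a k *\<^sub>R f k) < c * (\<Sum>k\<in>A. \<bar>a k\<bar>)"
    using no_l1_sequence[where f = f, OF fV fC c] by (elim exE conjE)
  then show False using bd[OF v_in, of A a] v_norm[of A a] J_sum[of A a] by simp
qed

lemma rosenthal_QV0: "rosenthal_space QV0 qnorm"
  using banach_on_QV0 not_contains_l1 by (simp add: rosenthal_space_def)

end

section \<open>Groups of homeomorphisms with the compact-open topology\<close>

lemma homeos_Bij: "f \<in> homeos S \<Longrightarrow> f \<in> Bij (topspace S)"
  by (auto simp: homeos_def Bij_def bij_betw_def
      homeomorphic_imp_surjective_map homeomorphic_imp_injective_map)

lemma homeos_subgroup: "subgroup (homeos S) (BijGroup (topspace S))"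
proof -
  interpret B: group "BijGroup (topspace S)" by (rule group_BijGroup)
  show ?thesis
  proof
    show "homeos S \<subseteq> carrier (BijGroup (topspace S))"
      using homeos_Bij by (auto simp: BijGroup_def)
    show "f \<otimes>\<^bsub>BijGroup (topspace S)\<^esub> g \<in> homeos S" if "f \<in> homeos S" "g \<in> homeos S" for f g
    proof -
      have "homeomorphic_map S S (compose (topspace S) f g)"
        by (rule homeomorphic_map_eq[of S S "f \<circ> g"])
          (use that homeomorphic_map_compose in \<open>auto simp: homeos_def compose_def\<close>)
      then show ?thesis using that homeos_Bij by (auto simp: BijGroup_def homeos_def)
    qed
    show "\<one>\<^bsub>BijGroup (topspace S)\<^esub> \<in> homeos S"
      using homeomorphic_map_eq[of S S id "\<lambda>x\<in>topspace S. x"]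
      by (auto simp: BijGroup_def homeos_def)
    show "inv\<^bsub>BijGroup (topspace S)\<^esub> f \<in> homeos S" if f: "f \<in> homeos S" for f
    proof -
      have "homeomorphic_map S S f" using f by (simp add: homeos_def)
      then obtain g where g: "homeomorphic_maps S S f g" unfolding homeomorphic_map_maps by blast
      then have hg: "homeomorphic_map S S g" by (metis homeomorphic_maps_map)
      have "homeomorphic_map S S (\<lambda>x\<in>topspace S. inv_into (topspace S) f x)"
      proof (rule homeomorphic_map_eq[OF hg])
        fix x assume x: "x \<in> topspace S"
        then have "f (g x) = x" "g x \<in> topspace S"
          using g homeomorphic_imp_surjective_map[OF hg] unfolding homeomorphic_maps_def by blast+
        moreover have "inj_on f (topspace S)" using f homeomorphic_imp_injective_map by (auto simp: homeos_def)
        ultimately show "g x = (\<lambda>x\<in>topspace S. inv_into (topspace S) f x) x"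
          using x by (metis inv_into_f_f restrict_apply')
      qed
      then show ?thesis using f by (simp add: inv_BijGroup homeos_Bij) (simp add: homeos_def)
    qed
  qed
qed

locale homeo_action = nested_halfspaces S HS
  for S :: "'a topology" and HS +
  fixes G :: "('a \<Rightarrow> 'a) set"
  assumes G_homeos: "G \<subseteq> homeos S"
    and G_subgroup: "subgroup G (BijGroup (topspace S))"
    and G_halfspaces: "\<lbrakk>g \<in> G; H \<in> HS\<rbrakk> \<Longrightarrow> {x \<in> topspace S. g x \<in> H} \<in> HS"
begin

definition Gr :: "('a \<Rightarrow> 'a) monoid"
  where "Gr = (BijGroup (topspace S))\<lparr>carrier := G\<rparr>"

definition T :: "('a \<Rightarrow> 'a) topology"
  where "T = subtopology (compact_open_topology S) G"

definition inverse_of :: "('a \<Rightarrow> 'a) \<Rightarrow> 'a \<Rightarrow> 'a"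
  where "inverse_of g = (\<lambda>x\<in>topspace S. inv_into (topspace S) g x)"

lemma carrier_Gr [simp]: "carrier Gr = G"
  by (simp add: Gr_def)

lemma group_Gr: "group Gr"
  unfolding Gr_def using G_subgroup group_BijGroup by (rule subgroup.subgroup_is_group)

lemma G_Bij: "g \<in> G \<Longrightarrow> g \<in> Bij (topspace S)"
  using G_homeos homeos_Bij by blast

lemma G_cont: "g \<in> G \<Longrightarrow> continuous_map S S g"
  using G_homeos by (auto simp: homeos_def homeomorphic_imp_continuous_map)

lemma G_in: "\<lbrakk>g \<in> G; x \<in> topspace S\<rbrakk> \<Longrightarrow> g x \<in> topspace S"
  using G_Bij Bij_imp_funcset by blast

lemma Gr_mult: "\<lbrakk>g \<in> G; h \<in> G\<rbrakk> \<Longrightarrow> g \<otimes>\<^bsub>Gr\<^esub> h = compose (topspace S) g h"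
  using G_Bij by (simp add: Gr_def BijGroup_def)

lemma compose_G: "\<lbrakk>g \<in> G; h \<in> G\<rbrakk> \<Longrightarrow> compose (topspace S) g h \<in> G"
  using Gr_mult group.is_monoid[OF group_Gr] monoid.m_closed by fastforce

lemma Gr_inv: "g \<in> G \<Longrightarrow> inv\<^bsub>Gr\<^esub> g = inverse_of g"
  unfolding Gr_def inverse_of_def
  using group.m_inv_consistent[OF group_BijGroup G_subgroup] inv_BijGroup[OF G_Bij] by simp

lemma inverse_G: "g \<in> G \<Longrightarrow> inverse_of g \<in> G"
  using group.inv_closed[OF group_Gr] Gr_inv by fastforce

lemma inverse_apply:
  assumes "g \<in> G" "x \<in> topspace S"
  shows "g (inverse_of g x) = x" "inverse_of g (g x) = x"
  using G_Bij[OF assms(1)] assms(2) G_in[OF assms]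
  unfolding Bij_def bij_betw_def inverse_of_def by (auto simp: f_inv_into_f)

lemma inverse_inverse: "g \<in> G \<Longrightarrow> inverse_of (inverse_of g) = g"
  using group.inv_inv[OF group_Gr] Gr_inv inverse_G by (metis carrier_Gr)

lemma G_eqI: "\<lbrakk>g \<in> G; h \<in> G; \<And>x. x \<in> topspace S \<Longrightarrow> g x = h x\<rbrakk> \<Longrightarrow> g = h"
  using G_Bij Bij_imp_extensional extensionalityI by metis

lemma topspace_T [simp]: "topspace T = G"
proof -
  \<comment> \<open>The subbasic set with \<open>K\<close> and \<open>U\<close> both empty is all of
    \<open>homeos S\<close>.\<close>
  have "homeos S \<subseteq> topspace (compact_open_topology S)"
    unfolding compact_open_topology_def topology_generated_by_topspace
    by (rule subsetI, rule UnionI[of "{f \<in> homeos S. f ` {} \<subseteq> {}}"]) (auto intro!: exI[of _ "{}"])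
  then show ?thesis using G_homeos unfolding T_def topspace_subtopology by blast
qed

lemma openin_T:
  assumes "compactin S K" "openin S U"
  shows "openin T {g \<in> G. g ` K \<subseteq> U}"
proof -
  have "openin (compact_open_topology S) {f \<in> homeos S. f ` K \<subseteq> U}"
    unfolding compact_open_topology_def
    by (rule topology_generated_by_Basis) (use assms in blast)
  moreover have "{g \<in> G. g ` K \<subseteq> U} = {f \<in> homeos S. f ` K \<subseteq> U} \<inter> G" using G_homeos by blast
  ultimately show ?thesis unfolding T_def openin_subtopology by blast
qed

lemma continuous_map_into_T:
  assumes "f \<in> topspace Z \<rightarrow> G"
    and op: "\<And>K U. \<lbrakk>compactin S K; openin S U\<rbrakk> \<Longrightarrow> openin Z {z \<in> topspace Z. f z ` K \<subseteq> U}"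
  shows "continuous_map Z T f"
  unfolding T_def continuous_map_in_subtopology
proof
  show "continuous_map Z (compact_open_topology S) f"
    unfolding compact_open_topology_def
  proof (rule continuous_on_generated_topo)
    fix W assume "W \<in> {{f \<in> homeos S. f ` K \<subseteq> U} |K U. compactin S K \<and> openin S U}"
    then obtain K U where W: "W = {f \<in> homeos S. f ` K \<subseteq> U}" "compactin S K" "openin S U" by blast
    have "f -` W \<inter> topspace Z = {z \<in> topspace Z. f z ` K \<subseteq> U}"
      using W(1) assms(1) G_homeos by blast
    then show "openin Z (f -` W \<inter> topspace Z)" using op W by simp
  next
    have "f ` topspace Z \<subseteq> topspace (compact_open_topology S)"
      using assms(1) topspace_T unfolding T_def topspace_subtopology by blast
    then show "f ` topspace Z \<subseteq> \<Union> {{f \<in> homeos S. f ` K \<subseteq> U} |K U. compactin S K \<and> openin S U}"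
      unfolding compact_open_topology_def topology_generated_by_topspace .
  qed
qed (use assms(1) in blast)

lemma Hausdorff: "Hausdorff_space S"
  unfolding Hausdorff_space_def
proof (intro allI impI, elim conjE)
  fix x y assume xy: "x \<in> topspace S" "y \<in> topspace S" "x \<noteq> y"
  obtain f where f: "continuous_map S euclideanreal f" "f x \<noteq> f y" using separation[OF xy] by blast
  obtain U V where UV: "open U" "open V" "f x \<in> U" "f y \<in> V" "U \<inter> V = {}"
    using hausdorff[OF f(2)] by blast
  have op: "openin S {z \<in> topspace S. f z \<in> W}" if "open W" for W
    using f(1) that unfolding continuous_map_def by simp
  show "\<exists>U V. openin S U \<and> openin S V \<and> x \<in> U \<and> y \<in> V \<and> disjnt U V"
    using op[OF UV(1)] op[OF UV(2)] UV xy
    by (intro exI[of _ "{z \<in> topspace S. f z \<in> U}"] exI[of _ "{z \<in> topspace S. f z \<in> V}"])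
      (auto simp: disjnt_iff)
qed

text \<open>Normality, in the form that supplies a compact test set for the compact-open topology
  together with an open set inside it.\<close>

lemma closed_neighbourhood:
  assumes "closedin S C" "openin S U" "C \<subseteq> U"
  obtains W where "openin S W" "C \<subseteq> W" "compactin S (S closure_of W)" "W \<subseteq> S closure_of W"
    "S closure_of W \<subseteq> U"
proof -
  have "normal_space S" using compact_Hausdorff_or_regular_imp_normal_space compact Hausdorff by blast
  then obtain W where W: "openin S W" "C \<subseteq> W" "S closure_of W \<subseteq> U"
    using assms unfolding normal_space_alt by metis
  then show ?thesis
    using that closure_of_subset[OF openin_subset] closedin_compact_space[OF compact closedin_closure_of]
    by blast
qed

lemma openin_preimage: "\<lbrakk>g \<in> G; openin S U\<rbrakk> \<Longrightarrow> openin S {x \<in> topspace S. g x \<in> U}"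
  using G_cont unfolding continuous_map_def by blast

lemma mult_continuous:
  "continuous_map (prod_topology T T) T (\<lambda>(g, h). g \<otimes>\<^bsub>Gr\<^esub> h)"
proof (rule continuous_map_into_T)
  show "(\<lambda>(g, h). g \<otimes>\<^bsub>Gr\<^esub> h) \<in> topspace (prod_topology T T) \<rightarrow> G"
    using compose_G Gr_mult by auto
  fix K U assume K: "compactin S K" and U: "openin S U"
  have KX: "K \<subseteq> topspace S" using K compactin_subset_topspace by blast
  have eq: "(g \<otimes>\<^bsub>Gr\<^esub> h) ` K \<subseteq> U \<longleftrightarrow> g ` h ` K \<subseteq> U" if "g \<in> G" "h \<in> G" for g h
  proof -
    have "(g \<otimes>\<^bsub>Gr\<^esub> h) ` K = g ` h ` K"
      using KX by (auto simp: Gr_mult that compose_def image_image intro!: image_cong)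
    then show ?thesis by simp
  qed
  let ?Z = "{z \<in> topspace (prod_topology T T). (\<lambda>(g, h). g \<otimes>\<^bsub>Gr\<^esub> h) z ` K \<subseteq> U}"
  show "openin (prod_topology T T) ?Z"
    unfolding openin_prod_topology_alt
  proof (intro allI impI)
    fix g h assume "(g, h) \<in> ?Z"
    then have gh: "g \<in> G" "h \<in> G" by auto
    have ghK: "g ` h ` K \<subseteq> U" using \<open>(g, h) \<in> ?Z\<close> eq[OF gh] by simp
    have hK: "compactin S (h ` K)" using image_compactin K G_cont gh by blast
    then have "closedin S (h ` K)" using compactin_imp_closedin Hausdorff by blast
    moreover have "h ` K \<subseteq> {x \<in> topspace S. g x \<in> U}" using ghK compactin_subset_topspace[OF hK] by blast
    ultimately obtain W where W: "openin S W" "h ` K \<subseteq> W" "compactin S (S closure_of W)"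
      "W \<subseteq> S closure_of W" "S closure_of W \<subseteq> {x \<in> topspace S. g x \<in> U}"
      using closed_neighbourhood[OF _ openin_preimage[OF gh(1) U], of "h ` K"] by blast
    show "\<exists>A B. openin T A \<and> openin T B \<and> g \<in> A \<and> h \<in> B \<and> A \<times> B \<subseteq> ?Z"
    proof (intro exI conjI)
      show "openin T {g \<in> G. g ` (S closure_of W) \<subseteq> U}" using openin_T W(3) U by blast
      show "openin T {h \<in> G. h ` K \<subseteq> W}" using openin_T K W(1) by blast
      show "{g \<in> G. g ` (S closure_of W) \<subseteq> U} \<times> {h \<in> G. h ` K \<subseteq> W} \<subseteq> ?Z"
      proof
        fix z assume "z \<in> {g \<in> G. g ` (S closure_of W) \<subseteq> U} \<times> {h \<in> G. h ` K \<subseteq> W}"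
        then obtain g' h' where gh': "z = (g', h')" "g' \<in> G" "h' \<in> G"
          "g' ` (S closure_of W) \<subseteq> U" "h' ` K \<subseteq> W" by blast
        then have "g' ` h' ` K \<subseteq> U" using W(4) by blast
        then show "z \<in> ?Z" using eq[OF gh'(2,3)] gh' by simp
      qed
    qed (use gh W in auto)
  qed
qed

text \<open>The inverse of \<open>g\<close> maps \<open>K\<close> into \<open>U\<close> iff
  \<open>g\<close> maps the complement of \<open>U\<close> into the complement of \<open>K\<close>.
  The former complement is compact and the latter open, as \<open>S\<close> is compact
  Hausdorff.\<close>

lemma inv_continuous: "continuous_map T T inverse_of"
proof (rule continuous_map_into_T)
  show "inverse_of \<in> topspace T \<rightarrow> G" using inverse_G by simp
  fix K U assume K: "compactin S K" and U: "openin S U"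
  have KX: "K \<subseteq> topspace S" using K compactin_subset_topspace by blast
  have "inverse_of g ` K \<subseteq> U \<longleftrightarrow> g ` (topspace S - U) \<subseteq> topspace S - K" if g: "g \<in> G" for g
  proof
    assume L: "inverse_of g ` K \<subseteq> U"
    show "g ` (topspace S - U) \<subseteq> topspace S - K"
    proof clarify
      fix x assume x: "x \<in> topspace S" "x \<notin> U"
      have "g x \<notin> K"
      proof
        assume "g x \<in> K"
        then have "inverse_of g (g x) \<in> U" using L by blast
        then show False using inverse_apply(2)[OF g x(1)] x by simp
      qed
      then show "g x \<in> topspace S - K" using G_in[OF g x(1)] by blast
    qed
  next
    assume L: "g ` (topspace S - U) \<subseteq> topspace S - K"
    show "inverse_of g ` K \<subseteq> U"
    proof clarify
      fix x assume x: "x \<in> K"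
      show "inverse_of g x \<in> U"
      proof (rule ccontr)
        assume "inverse_of g x \<notin> U"
        then have "g (inverse_of g x) \<in> topspace S - K"
          using L G_in[OF inverse_G[OF g]] x KX by blast
        then show False using inverse_apply(1)[OF g] x KX by auto
      qed
    qed
  qed
  then have "{z \<in> topspace T. inverse_of z ` K \<subseteq> U} = {g \<in> G. g ` (topspace S - U) \<subseteq> topspace S - K}"
    by (simp cong: conj_cong)
  moreover have "compactin S (topspace S - U)"
    using closedin_compact_space[OF compact] U by blast
  moreover have "openin S (topspace S - K)"
    using compactin_imp_closedin[OF Hausdorff K] by blast
  ultimately show "openin T {z \<in> topspace T. inverse_of z ` K \<subseteq> U}" using openin_T by simp
qed

lemma topological_group_Gr: "topological_group Gr T"
  unfolding topological_group_def
proof (intro conjI)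
  show "continuous_map T T (\<lambda>g. inv\<^bsub>Gr\<^esub> g)"
    by (rule continuous_map_eq[OF inv_continuous]) (simp add: Gr_inv)
qed (use group_Gr mult_continuous in auto)

lemma continuous_action_Gr: "continuous_action Gr T S (\<lambda>g. g)"
  unfolding continuous_action_def
proof (intro conjI topological_group_Gr)
  show "group_action Gr (topspace S) (\<lambda>g. g)"
    unfolding group_action_def group_hom_def group_hom_axioms_def
    using group_Gr group_BijGroup G_Bij by (auto simp: hom_def) (auto simp: Gr_def BijGroup_def)
  show "continuous_map (prod_topology T S) S (\<lambda>(g, x). g x)"
    unfolding continuous_map_def
  proof (intro conjI allI impI)
    show "(\<lambda>(g, x). g x) \<in> topspace (prod_topology T S) \<rightarrow> topspace S" using G_in by auto
    fix U assume U: "openin S U"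
    let ?Z = "{z \<in> topspace (prod_topology T S). (\<lambda>(g, x). g x) z \<in> U}"
    show "openin (prod_topology T S) ?Z"
      unfolding openin_prod_topology_alt
    proof (intro allI impI)
      fix g x assume "(g, x) \<in> ?Z"
      then have gx: "g \<in> G" "x \<in> topspace S" "g x \<in> U" by auto
      have "closedin S {x}" using gx Hausdorff by (simp add: closedin_Hausdorff_singleton)
      then obtain W where W: "openin S W" "{x} \<subseteq> W" "compactin S (S closure_of W)"
        "W \<subseteq> S closure_of W" "S closure_of W \<subseteq> {x \<in> topspace S. g x \<in> U}"
        using closed_neighbourhood[of "{x}"] openin_preimage[OF gx(1) U] gx by auto
      show "\<exists>A B. openin T A \<and> openin S B \<and> g \<in> A \<and> x \<in> B \<and> A \<times> B \<subseteq> ?Z"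
      proof (intro exI conjI)
        show "openin T {g \<in> G. g ` (S closure_of W) \<subseteq> U}" using openin_T W(3) U by blast
        show "openin S W" by fact
        show "{g \<in> G. g ` (S closure_of W) \<subseteq> U} \<times> W \<subseteq> ?Z"
          using W(4) openin_subset[OF W(1)] by auto
      qed (use gx W in auto)
    qed
  qed
qed

end

section \<open>The regular representation\<close>

lemma isometries_Bij: "f \<in> isometries V N \<Longrightarrow> f \<in> Bij V"
  by (auto simp: isometries_def Bij_def)

lemma isometries_subgroup:
  assumes V: "subspace V"
  shows "subgroup (isometries V N) (BijGroup V)"
proof -
  interpret B: group "BijGroup V" by (rule group_BijGroup)
  show ?thesis
  proof
    show "isometries V N \<subseteq> carrier (BijGroup V)"
      using isometries_Bij by (auto simp: BijGroup_def)
    show "f \<otimes>\<^bsub>BijGroup V\<^esub> g \<in> isometries V N" if fg: "f \<in> isometries V N" "g \<in> isometries V N" for f g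
    proof -
      have "g x \<in> V" if "x \<in> V" for x
        using isometries_Bij[OF fg(2)] Bij_imp_funcset that by blast
      then have "linear_map_on V (compose V f g)" "\<forall>x\<in>V. N (compose V f g x) = N x"
        using fg subspace_add[OF V] subspace_scale[OF V]
        by (auto simp: isometries_def linear_map_on_def compose_def)
      moreover have "compose V f g \<in> Bij V" using compose_Bij isometries_Bij fg by blast
      ultimately show ?thesis
        using fg isometries_Bij by (auto simp: BijGroup_def isometries_def Bij_def)
    qed
    show "\<one>\<^bsub>BijGroup V\<^esub> \<in> isometries V N"
      using subspace_add[OF V] subspace_scale[OF V] id_Bij[of V]
      by (auto simp: BijGroup_def isometries_def linear_map_on_def Bij_def)
    show "inv\<^bsub>BijGroup V\<^esub> f \<in> isometries V N" if f: "f \<in> isometries V N" for f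
    proof -
      define i where "i = (\<lambda>x\<in>V. inv_into V f x)"
      have fB: "f ` V = V" "inj_on f V" using f by (auto simp: isometries_def bij_betw_def)
      have i: "i x \<in> V" "f (i x) = x" if "x \<in> V" for x
        using that fB by (auto simp: i_def inv_into_into f_inv_into_f)
      have uniq: "i x = y" if "x \<in> V" "y \<in> V" "f y = x" for x y
        using that fB i by (metis inj_onD)
      have lin: "f (x + y) = f x + f y" "f (c *\<^sub>R x) = c *\<^sub>R f x" if "x \<in> V" "y \<in> V" for x y c
        using f that by (auto simp: isometries_def linear_map_on_def)
      have "linear_map_on V i"
        unfolding linear_map_on_def
        using uniq i lin subspace_add[OF V] subspace_scale[OF V] by auto
      moreover have "N (i x) = N x" if "x \<in> V" for x
        using f i that by (force simp: isometries_def)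
      moreover have "i \<in> Bij V" unfolding i_def using restrict_inv_into_Bij isometries_Bij f by blast
      ultimately have "i \<in> isometries V N" by (auto simp: isometries_def Bij_def)
      then show ?thesis using inv_BijGroup[OF isometries_Bij[OF f]] by (simp add: i_def)
    qed
  qed
qed

section \<open>Precomposition with group elements\<close>

context homeo_action
begin

definition shift :: "('a \<Rightarrow> 'a) \<Rightarrow> ('a \<Rightarrow> real) \<Rightarrow> 'a \<Rightarrow> real"
  where "shift g v x = (if x \<in> topspace S then v (g x) else 0)"

text \<open>A halfspace separating the image of a pair pulls back along \<open>g\<close> to a
  halfspace separating the pair itself.\<close>

lemma admissible_image:
  assumes g: "g \<in> G" and P: "admissible P"
  shows "admissible (map_prod g g ` P)" "inj_on (map_prod g g) P"
proof -
  have PX: "P \<subseteq> topspace S \<times> topspace S" "finite P" using P unfolding admissible_def by auto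
  have inj: "inj_on g (topspace S)" using G_Bij[OF g] by (simp add: Bij_def bij_betw_def)
  show "inj_on (map_prod g g) P"
    using inj_on_subset[OF map_prod_inj_on[OF inj inj] PX(1)] .
  have sep: "separates {x \<in> topspace S. g x \<in> H} p" if "separates H (map_prod g g p)" "p \<in> P" for H p
    using that PX by (cases p) (auto simp: separates_def)
  show "admissible (map_prod g g ` P)"
    unfolding admissible_def
  proof (intro conjI ballI impI)
    show "finite (map_prod g g ` P)" using PX by simp
    show "map_prod g g ` P \<subseteq> topspace S \<times> topspace S" using PX G_in[OF g] by auto
    fix H p q assume H: "H \<in> HS" and pq: "p \<in> map_prod g g ` P" "q \<in> map_prod g g ` P"
      "separates H p \<and> separates H q"
    from pq(1) obtain p' where p': "p = map_prod g g p'" "p' \<in> P" by (rule imageE)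
    from pq(2) obtain q' where q': "q = map_prod g g q'" "q' \<in> P" by (rule imageE)
    from p' q' show "p = q"
      using sep[of H p'] sep[of H q'] pq(3) P G_halfspaces[OF g H] unfolding admissible_def by metis
  qed
qed

lemma shift_difference:
  assumes "admissible P" "p \<in> P"
  shows "shift g v (fst p) - shift g v (snd p) = v (fst (map_prod g g p)) - v (snd (map_prod g g p))"
  using assms unfolding admissible_def by (cases p) (auto simp: shift_def)

lemma shift_osc:
  assumes g: "g \<in> G" and P: "admissible P"
  shows "osc (shift g v) P = osc v (map_prod g g ` P)"
  unfolding osc_def L2_set_def sum.reindex[OF admissible_image(2)[OF assms]]
  by (intro arg_cong[of _ _ sqrt] sum.cong refl)
    (simp only: shift_difference[OF P] comp_apply)

text \<open>Precomposition reverses products, which is why the representation is a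
  co-homomorphism.\<close>

lemma shift_shift: "\<lbrakk>g \<in> G; h \<in> G\<rbrakk> \<Longrightarrow> shift g (shift h v) = shift (compose (topspace S) h g) v"
  by (auto simp: shift_def compose_def G_in)

lemma shift_inverse:
  assumes "g \<in> G" "v \<in> QV"
  shows "shift g (shift (inverse_of g) v) = v" "shift (inverse_of g) (shift g v) = v"
  using assms inverse_apply[OF assms(1)] G_in[OF assms(1)] G_in[OF inverse_G[OF assms(1)]] QV_outside[OF assms(2)]
  by (auto simp: shift_def fun_eq_iff)

lemma shift_QV_le:
  assumes g: "g \<in> G" and v: "v \<in> QV"
  shows "shift g v \<in> QV \<and> qnorm (shift g v) \<le> qnorm v"
proof -
  have *: "\<bar>shift g v x\<bar> + osc (shift g v) P \<le> qnorm v" if P: "admissible P" for x P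
  proof (cases "x \<in> topspace S")
    case True
    then show ?thesis
      using qnorm_upper[OF v admissible_image(1)[OF g P], of "g x"]
      by (simp add: shift_osc[OF g P] shift_def)
  next
    case False
    then show ?thesis
      using osc_le_qnorm[OF v admissible_image(1)[OF g P]]
      by (simp add: shift_osc[OF g P] shift_def)
  qed
  have "shift g v \<in> QV" by (rule QV_I[OF _ *]) (auto simp: shift_def)
  then show ?thesis using qnorm_least[OF _ *] by blast
qed

lemma shift_QV: "\<lbrakk>g \<in> G; v \<in> QV\<rbrakk> \<Longrightarrow> shift g v \<in> QV"
  using shift_QV_le by blast

lemma qnorm_shift:
  assumes "g \<in> G" "v \<in> QV"
  shows "qnorm (shift g v) = qnorm v"
proof -
  have "qnorm v \<le> qnorm (shift g v)"
    using shift_QV_le[OF inverse_G[OF assms(1)] shift_QV[OF assms]] by (simp add: shift_inverse assms)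
  then show ?thesis using shift_QV_le[OF assms] by linarith
qed

lemma shift_add: "shift g (v + w) = shift g v + shift g w"
  by (auto simp: shift_def plus_fun_def)

lemma shift_diff: "shift g (v - w) = shift g v - shift g w"
  by (auto simp: shift_def fun_diff_def)

lemma shift_scaleR: "shift g (c *\<^sub>R v) = c *\<^sub>R shift g v"
  by (auto simp: shift_def scaleR_fun_def)

lemma shift_variation:
  assumes g: "g \<in> G" and P: "admissible P"
    and B: "\<And>P. admissible P \<Longrightarrow> (\<Sum>p\<in>P. \<bar>w (fst p) - w (snd p)\<bar>) \<le> B"
  shows "(\<Sum>p\<in>P. \<bar>shift g w (fst p) - shift g w (snd p)\<bar>) \<le> B"
proof -
  have "(\<Sum>p\<in>P. \<bar>shift g w (fst p) - shift g w (snd p)\<bar>) =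
      (\<Sum>p\<in>map_prod g g ` P. \<bar>w (fst p) - w (snd p)\<bar>)"
    unfolding sum.reindex[OF admissible_image(2)[OF g P]]
    by (intro sum.cong refl) (simp only: shift_difference[OF P] comp_apply)
  then show ?thesis using B[OF admissible_image(1)[OF g P]] by simp
qed

lemma shift_continuous:
  assumes "g \<in> G" "continuous_map S euclideanreal v"
  shows "continuous_map S euclideanreal (shift g v)"
  by (rule continuous_map_eq[OF continuous_map_compose[OF G_cont[OF assms(1)] assms(2)]])
    (simp add: shift_def)

lemma shift_BV:
  assumes "g \<in> G" "w \<in> BV"
  shows "shift g w \<in> BV"
proof -
  obtain B M where B: "\<And>x. \<bar>w x\<bar> \<le> M"
    "\<And>P. admissible P \<Longrightarrow> (\<Sum>p\<in>P. \<bar>w (fst p) - w (snd p)\<bar>) \<le> B"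
    using assms unfolding BV_def by blast
  have "0 \<le> M" using order_trans[OF abs_ge_zero B(1)] .
  then have "\<bar>shift g w x\<bar> \<le> M" for x using B(1) by (simp add: shift_def)
  moreover have "continuous_map S euclideanreal (shift g w)"
    using shift_continuous assms unfolding BV_def by blast
  moreover have "shift g w x = 0" if "x \<notin> topspace S" for x using that by (simp add: shift_def)
  moreover have "\<exists>B. \<forall>P. admissible P \<longrightarrow> (\<Sum>p\<in>P. \<bar>shift g w (fst p) - shift g w (snd p)\<bar>) \<le> B"
    using shift_variation[OF assms(1) _ B(2)] by blast
  ultimately show ?thesis unfolding BV_def by blast
qed

lemma shift_QV0:
  assumes "g \<in> G" "v \<in> QV0"
  shows "shift g v \<in> QV0"
proof -
  have "\<exists>w\<in>BV. qnorm (shift g v - w) < e" if e: "0 < e" for e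
  proof -
    obtain w where w: "w \<in> BV" "qnorm (v - w) < e" using QV0_approx[OF assms(2) e] by blast
    then have "qnorm (shift g v - shift g w) < e"
      using qnorm_shift[OF assms(1) QV_diff(1)] QV0_QV assms BV_QV by (simp add: shift_diff)
    then show ?thesis using shift_BV[OF assms(1) w(1)] by blast
  qed
  then show ?thesis using shift_QV QV0_QV assms unfolding QV0_def by blast
qed

definition rep :: "('a \<Rightarrow> 'a) \<Rightarrow> ('a \<Rightarrow> real) \<Rightarrow> 'a \<Rightarrow> real"
  where "rep g = (\<lambda>v\<in>QV0. shift g v)"

lemma rep_isometry:
  assumes g: "g \<in> G"
  shows "rep g \<in> isometries QV0 qnorm"
proof -
  have "bij_betw (shift g) QV0 QV0"
    by (rule bij_betw_byWitness[where f' = "shift (inverse_of g)"])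
      (use shift_inverse g shift_QV0 inverse_G QV0_QV in auto)
  then have "bij_betw (rep g) QV0 QV0"
    by (rule bij_betw_cong[THEN iffD1, rotated]) (simp add: rep_def)
  moreover have "linear_map_on QV0 (rep g)"
    unfolding linear_map_on_def rep_def
    using subspace_add[OF subspace_QV0] subspace_scale[OF subspace_QV0] shift_add shift_scaleR by auto
  moreover have "qnorm (rep g v) = qnorm v" if "v \<in> QV0" for v
    using qnorm_shift[OF g QV0_QV[OF that]] that by (simp add: rep_def)
  ultimately show ?thesis unfolding isometries_def by (auto simp: rep_def)
qed

lemma rep_mult:
  assumes "g \<in> G" "h \<in> G"
  shows "rep (g \<otimes>\<^bsub>Gr\<^esub> h) = rep h \<otimes>\<^bsub>Is QV0 qnorm\<^esub> rep g"
proof -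
  have "rep h \<otimes>\<^bsub>Is QV0 qnorm\<^esub> rep g = compose QV0 (rep h) (rep g)"
    using isometries_Bij[OF rep_isometry] assms by (simp add: Is_def BijGroup_def)
  also have "\<dots> = rep (g \<otimes>\<^bsub>Gr\<^esub> h)"
    using shift_QV0[OF assms(1)]
    by (auto simp: compose_def rep_def Gr_mult[OF assms] shift_shift[OF assms(2,1)] fun_eq_iff restrict_def)
  finally show ?thesis by simp
qed

text \<open>The range of w is cut into finitely many intervals of length d/2.\<close>

lemma shift_uniformly_close:
  assumes w: "continuous_map S euclideanreal w" "\<And>x. \<bar>w x\<bar> \<le> M" and g0: "g0 \<in> G" and d: "0 < d"
  shows "\<exists>U. openin T U \<and> g0 \<in> U \<and> (\<forall>g\<in>U. \<forall>x. \<bar>shift g w x - shift g0 w x\<bar> \<le> d)"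
proof -
  define c where "c = d / 2"
  have c: "0 < c" using d by (simp add: c_def)
  define n where "n = \<lceil>M / c\<rceil> + 1"
  define K where "K i = {x \<in> topspace S. w (g0 x) \<in> {of_int i * c..(of_int i + 1) * c}}" for i :: int
  \<comment> \<open>One cell wider on either side, so two values attached to the same
    \<open>i\<close> differ by less than \<open>2 * c = d\<close>.\<close>
  define O' where "O' i = {x \<in> topspace S. w x \<in> {(of_int i - 1) * c<..<(of_int i + 2) * c}}" for i :: int
  define U where "U = G \<inter> (\<Inter>i\<in>{-n..n}. {g \<in> G. g ` K i \<subseteq> O' i})"
  have "continuous_map S euclideanreal (\<lambda>x. w (g0 x))"
    using continuous_map_compose[OF G_cont[OF g0] w(1)] by (simp add: o_def)
  then have "compactin S (K i)" for i
    unfolding K_def by (intro closedin_compact_space[OF compact] closedin_continuous_map_preimage) auto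
  moreover have "openin S (O' i)" for i
    unfolding O'_def by (intro openin_continuous_map_preimage[OF w(1)]) auto
  ultimately have "openin T {g \<in> G. g ` K i \<subseteq> O' i}" for i using openin_T by blast
  moreover have "openin T G" by (metis openin_topspace topspace_T)
  ultimately have "openin T U"
    unfolding U_def by (cases "{-n..n} = {}") (auto intro!: openin_Int openin_INT2)
  moreover have "g0 \<in> U"
  proof -
    have "g0 ` K i \<subseteq> O' i" for i
      using G_in[OF g0] c unfolding K_def O'_def by (auto simp: algebra_simps)
    then show ?thesis using g0 unfolding U_def by blast
  qed
  moreover have "\<bar>shift g w x - shift g0 w x\<bar> \<le> d" if g: "g \<in> U" for g x
  proof (cases "x \<in> topspace S")
    case True
    define i where "i = \<lfloor>w (g0 x) / c\<rfloor>"
    have i: "of_int i \<le> w (g0 x) / c" "w (g0 x) / c < of_int i + 1" unfolding i_def by linarith+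
    have "\<bar>w (g0 x)\<bar> / c \<le> M / c" using w(2) c by (intro divide_right_mono) auto
    then have "\<bar>w (g0 x) / c\<bar> \<le> M / c" using c by simp
    then have "i \<in> {-n..n}" unfolding i_def n_def by (simp; linarith)
    moreover have x: "x \<in> K i" using i c True unfolding K_def by (simp add: field_simps)
    ultimately have "g x \<in> O' i" using g unfolding U_def by blast
    then show ?thesis using x True unfolding K_def O'_def c_def
      by (simp add: shift_def abs_le_iff algebra_simps)
  next
    case False
    then show ?thesis using d by (simp add: shift_def)
  qed
  ultimately show ?thesis by blast
qed

lemma shift_BV_close:
  assumes w: "w \<in> BV" and g0: "g0 \<in> G" and e: "0 < e"
  shows "\<exists>U. openin T U \<and> g0 \<in> U \<and> (\<forall>g\<in>U. qnorm (shift g w - shift g0 w) < e)"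
proof -
  obtain B M where B: "\<And>x. \<bar>w x\<bar> \<le> M"
    "\<And>P. admissible P \<Longrightarrow> (\<Sum>p\<in>P. \<bar>w (fst p) - w (snd p)\<bar>) \<le> B"
    and cont: "continuous_map S euclideanreal w"
    using w unfolding BV_def by blast
  have B0: "0 \<le> B" using B(2)[OF admissible_empty] by simp
  \<comment> \<open>The difference of two translates has variation at most \<open>2 * B\<close>, so
    its norm is at most \<open>d + sqrt (2 * d * (2 * B))\<close>; the two bounds make this at most
    \<open>e / 4 + e / 2\<close>.\<close>
  define d where "d = min (e / 4) (e\<^sup>2 / (16 * (B + 1)))"
  have d: "0 < d" "d \<le> e / 4" using e B0 unfolding d_def by (simp, intro min.cobounded1)
  have "d \<le> e\<^sup>2 / (16 * (B + 1))" unfolding d_def by (rule min.cobounded2)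
  then have "d * (16 * (B + 1)) \<le> e\<^sup>2" using B0 by (subst (asm) pos_le_divide_eq) auto
  then have "2 * d * (2 * B) \<le> (e / 2)\<^sup>2" using d by (simp add: power2_eq_square algebra_simps)
  then have sq: "sqrt (2 * d * (2 * B)) \<le> e / 2" using e by (intro real_le_lsqrt) auto
  obtain U where U: "openin T U" "g0 \<in> U" "\<And>g x. g \<in> U \<Longrightarrow> \<bar>shift g w x - shift g0 w x\<bar> \<le> d"
    using shift_uniformly_close[OF cont B(1) g0 d(1)] by blast
  have "qnorm (shift g w - shift g0 w) < e" if gU: "g \<in> U" for g
  proof -
    have g: "g \<in> G" using openin_subset[OF U(1)] gU by auto
    let ?z = "shift g w - shift g0 w"
    have z: "\<bar>?z x\<bar> \<le> d" for x using U(3)[OF gU] by (simp add: fun_diff_def)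
    have var: "(\<Sum>p\<in>P. \<bar>?z (fst p) - ?z (snd p)\<bar>) \<le> 2 * B" if P: "admissible P" for P
    proof -
      have "(\<Sum>p\<in>P. \<bar>?z (fst p) - ?z (snd p)\<bar>) \<le>
        (\<Sum>p\<in>P. \<bar>shift g w (fst p) - shift g w (snd p)\<bar> + \<bar>shift g0 w (fst p) - shift g0 w (snd p)\<bar>)"
        by (rule sum_mono) (simp add: fun_diff_def)
      then show ?thesis
        using shift_variation[OF g P B(2)] shift_variation[OF g0 P B(2)] by (simp add: sum.distrib)
    qed
    have "?z \<in> QV" using QV_diff(1) shift_QV BV_QV w g g0 by blast
    then have "qnorm ?z \<le> d + sqrt (2 * d * (2 * B))"
      by (rule qnorm_least) (use z var osc_le_variation[of ?z d _ "2 * B"] in \<open>auto intro!: add_mono\<close>)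
    then show ?thesis using sq d e by linarith
  qed
  then show ?thesis using U by blast
qed

text \<open>Translates are isometric, so continuity of orbit maps passes from \<open>BV\<close> to
  its closure; two of the three errors equal the norm of \<open>v - w\<close>.\<close>

lemma shift_close:
  assumes v: "v \<in> QV0" and g0: "g0 \<in> G" and e: "0 < e"
  shows "\<exists>U. openin T U \<and> g0 \<in> U \<and> (\<forall>g\<in>U. qnorm (shift g v - shift g0 v) < e)"
proof -
  have "0 < e / 3" using e by simp
  then obtain w where w: "w \<in> BV" "qnorm (v - w) < e / 3" using QV0_approx[OF v] by blast
  obtain U where U: "openin T U" "g0 \<in> U" "\<And>g. g \<in> U \<Longrightarrow> qnorm (shift g w - shift g0 w) < e / 3"
    using shift_BV_close[OF w(1) g0 \<open>0 < e / 3\<close>] by blast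
  have vw: "v - w \<in> QV" using QV_diff(1) QV0_QV v BV_QV w by blast
  have "qnorm (shift g v - shift g0 v) < e" if gU: "g \<in> U" for g
  proof -
    have g: "g \<in> G" using openin_subset[OF U(1)] gU by auto
    have z: "shift g w - shift g0 w \<in> QV" using QV_diff(1) shift_QV BV_QV w g g0 by blast
    have 1: "shift g (v - w) - shift g0 (v - w) \<in> QV"
      "qnorm (shift g (v - w) - shift g0 (v - w)) \<le> qnorm (v - w) + qnorm (v - w)"
      using QV_diff[OF shift_QV[OF g vw] shift_QV[OF g0 vw]] by (simp_all add: qnorm_shift g g0 vw)
    have "shift g v - shift g0 v = (shift g w - shift g0 w) + (shift g (v - w) - shift g0 (v - w))"
      by (simp add: shift_diff)
    then have "qnorm (shift g v - shift g0 v) \<le>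
        qnorm (shift g w - shift g0 w) + qnorm (shift g (v - w) - shift g0 (v - w))"
      using QV_add(2)[OF z 1(1)] by simp
    then show ?thesis using 1(2) w(2) U(3)[OF gU] by linarith
  qed
  then show ?thesis using U by blast
qed

lemma rep_continuous: "continuous_map T (sot QV0 qnorm) rep"
proof -
  interpret M: Metric_space QV0 "\<lambda>v w. qnorm (v - w)" by (rule Metric_space_QV0)
  have "continuous_map T M.mtopology (\<lambda>g. rep g v)" if v: "v \<in> QV0" for v
    unfolding M.continuous_map_to_metric
  proof (intro ballI allI impI)
    fix g0 and e :: real assume g0: "g0 \<in> topspace T" and e: "0 < e"
    obtain U where U: "openin T U" "g0 \<in> U" "\<And>g. g \<in> U \<Longrightarrow> qnorm (shift g v - shift g0 v) < e"
      using shift_close[OF v _ e, of g0] g0 unfolding topspace_T by blast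
    have "rep g v \<in> M.mball (rep g0 v) e" if "g \<in> U" for g
      using U(3)[OF that] openin_subset[OF U(1)] that g0 v shift_QV0 M.commute
      by (auto simp: M.in_mball rep_def)
    then show "\<exists>U. openin T U \<and> g0 \<in> U \<and> (\<forall>g\<in>U. rep g v \<in> M.mball (rep g0 v) e)"
      using U by blast
  qed
  then show ?thesis
    using rep_isometry
    by (auto simp: sot_def norm_topology_def continuous_map_in_subtopology continuous_map_componentwise
        rep_def)
qed

section \<open>Evaluation functionals and the embedding of the space\<close>

definition ev :: "'a \<Rightarrow> ('a \<Rightarrow> real) \<Rightarrow> real"
  where "ev x = (\<lambda>v\<in>QV0. v x)"

lemma ev_dual: "ev x \<in> dual_space QV0 qnorm"
proof -
  have "\<bar>ev x v\<bar> \<le> 1 * qnorm v" if "v \<in> QV0" for v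
    using abs_le_qnorm[OF QV0_QV[OF that]] that by (simp add: ev_def)
  moreover have "linear_map_on QV0 (ev x)"
    unfolding linear_map_on_def ev_def
    using subspace_add[OF subspace_QV0] subspace_scale[OF subspace_QV0]
    by (auto simp: plus_fun_def scaleR_fun_def)
  moreover have "ev x \<in> extensional QV0" by (simp add: ev_def)
  ultimately show ?thesis unfolding dual_space_def by blast
qed

lemma ev_continuous: "continuous_map S (weak_star QV0 qnorm) ev"
proof -
  have "continuous_map S euclideanreal (\<lambda>x. ev x v)" if "v \<in> QV0" for v
    using QV0_continuous[OF that] that by (simp add: ev_def)
  moreover have "ev ` topspace S \<subseteq> extensional QV0" by (auto simp: ev_def)
  ultimately show ?thesis
    using ev_dual by (simp add: weak_star_def continuous_map_in_subtopology continuous_map_componentwise)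
qed

lemma ev_embedding: "embedding_map S (weak_star QV0 qnorm) ev"
proof (rule injective_closed_imp_embedding_map[OF ev_continuous])
  have "Hausdorff_space (weak_star QV0 qnorm)"
    unfolding weak_star_def
    by (intro Hausdorff_space_subtopology) (simp add: Hausdorff_space_product_topology)
  then show "closed_map S (weak_star QV0 qnorm) ev"
    using continuous_imp_closed_map[OF ev_continuous compact] by blast
  show "inj_on ev (topspace S)"
  proof (rule inj_onI, rule ccontr)
    fix x y assume xy: "x \<in> topspace S" "y \<in> topspace S" "ev x = ev y" "x \<noteq> y"
    obtain w where w: "w \<in> BV" "w x \<noteq> w y" using BV_separation xy by blast
    then show False using BV_QV0[OF w(1)] fun_cong[OF xy(3), of w] by (simp add: ev_def)
  qed
qed

lemma representation_Gr: "representation Gr T S (\<lambda>g. g) QV0 qnorm rep ev"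
  unfolding representation_def
proof (intro conjI)
  show "\<forall>g\<^sub>1\<in>carrier Gr. \<forall>g\<^sub>2\<in>carrier Gr. rep (g\<^sub>1 \<otimes>\<^bsub>Gr\<^esub> g\<^sub>2) = rep g\<^sub>2 \<otimes>\<^bsub>Is QV0 qnorm\<^esub> rep g\<^sub>1"
    using rep_mult by simp
  show "\<exists>B. \<forall>x\<in>topspace S. \<forall>v\<in>QV0. \<bar>ev x v\<bar> \<le> B * qnorm v"
    using abs_le_qnorm[OF QV0_QV] by (intro exI[of _ 1]) (simp add: ev_def)
  show "\<forall>v\<in>QV0. \<forall>g\<in>carrier Gr. \<forall>x\<in>topspace S. ev (g x) v = ev x (rep g v)"
    using shift_QV0 by (simp add: ev_def rep_def shift_def)
qed (use rep_continuous ev_continuous in auto)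

lemma representable_action: "rosenthal_representable_action TYPE('a \<Rightarrow> real) Gr T S (\<lambda>g. g)"
  unfolding rosenthal_representable_action_def
  using continuous_action_Gr rosenthal_QV0 representation_Gr ev_embedding by blast

section \<open>The group topology recovered from the strong operator topology\<close>

lemma rep_inj: "inj_on rep G"
proof (rule inj_onI)
  fix g h assume gh: "g \<in> G" "h \<in> G" "rep g = rep h"
  show "g = h"
  proof (rule G_eqI[OF gh(1,2)], rule ccontr)
    fix x assume x: "x \<in> topspace S" "g x \<noteq> h x"
    obtain w where w: "w \<in> BV" "w (g x) \<noteq> w (h x)" using BV_separation x G_in gh by blast
    have "rep g w x = rep h w x" using gh(3) by simp
    then show False using w BV_QV0[OF w(1)] x by (simp add: rep_def shift_def)
  qed
qed

lemma rep_reflects_neighbourhoods: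
  assumes g0: "g0 \<in> G" and K: "compactin S K" and U: "openin S U" and g0K: "g0 ` K \<subseteq> U"
  obtains J where "finite J" "J \<subseteq> QV0 \<times> {0<..}"
    "\<And>g. \<lbrakk>g \<in> G; \<And>v d. (v, d) \<in> J \<Longrightarrow> qnorm (shift g v - shift g0 v) < d\<rbrakk> \<Longrightarrow> g ` K \<subseteq> U"
proof -
  let ?D = "topspace S - U"
  define N where "N j = {z \<in> topspace (prod_topology S S). snd j < \<bar>fst j (fst z) - fst j (snd z)\<bar>}"
    for j :: "('a \<Rightarrow> real) \<times> real"
  have KX: "K \<subseteq> topspace S" using K compactin_subset_topspace by blast
  have gK: "compactin S (g0 ` K)" using image_compactin K G_cont[OF g0] by blast
  have "compactin S ?D" using closedin_compact_space[OF compact] U by blast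
  then have comp: "compactin (prod_topology S S) (g0 ` K \<times> ?D)"
    using gK by (simp add: compactin_Times)
  have op: "openin (prod_topology S S) (N j)" if "j \<in> QV0 \<times> {0<..}" for j
  proof -
    have v: "continuous_map S euclideanreal (fst j)" using QV0_continuous that by auto
    have "continuous_map (prod_topology S S) euclideanreal (\<lambda>z. \<bar>fst j (fst z) - fst j (snd z)\<bar>)"
      using continuous_map_compose[OF continuous_map_fst v] continuous_map_compose[OF continuous_map_snd v]
      by (intro continuous_map_real_abs continuous_map_diff) (simp_all add: o_def)
    then show ?thesis
      using openin_continuous_map_preimage[of "prod_topology S S" euclideanreal _ "{snd j<..}"]
      unfolding N_def by simp
  qed
  have cover: "g0 ` K \<times> ?D \<subseteq> \<Union> (N ` (QV0 \<times> {0<..}))"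
  proof clarify
    fix x z assume xz: "x \<in> K" "z \<in> topspace S" "z \<notin> U"
    have p: "g0 x \<in> topspace S" "g0 x \<noteq> z" using xz g0K KX G_in[OF g0] by auto
    obtain w where w: "w \<in> BV" "w (g0 x) \<noteq> w z" using BV_separation[OF p(1) xz(2) p(2)] by blast
    \<comment> \<open>Half the gap, so that the inequality defining \<open>N\<close> is strict and
      the threshold positive.\<close>
    have "(g0 x, z) \<in> N (w, \<bar>w (g0 x) - w z\<bar> / 2)" using w p xz by (simp add: N_def)
    moreover have "(w, \<bar>w (g0 x) - w z\<bar> / 2) \<in> QV0 \<times> {0<..}" using w BV_QV0 by simp
    ultimately show "(g0 x, z) \<in> \<Union> (N ` (QV0 \<times> {0<..}))" by blast
  qed
  have "\<exists>\<F>. finite \<F> \<and> \<F> \<subseteq> N ` (QV0 \<times> {0<..}) \<and> g0 ` K \<times> ?D \<subseteq> \<Union> \<F>"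
    by (rule compactinD[OF comp _ cover]) (use op in blast)
  then obtain J where J: "finite J" "J \<subseteq> QV0 \<times> {0<..}" "g0 ` K \<times> ?D \<subseteq> \<Union> (N ` J)"
    by (metis finite_subset_image)
  have main: "g ` K \<subseteq> U"
    if g: "g \<in> G" and close: "\<And>v d. (v, d) \<in> J \<Longrightarrow> qnorm (shift g v - shift g0 v) < d" for g
  proof (rule ccontr)
    assume "\<not> g ` K \<subseteq> U"
    then obtain x where x: "x \<in> K" "g x \<notin> U" by blast
    then have "(g0 x, g x) \<in> \<Union> (N ` J)" using J(3) KX G_in[OF g] by blast
    then obtain v d where vd: "(v, d) \<in> J" "d < \<bar>v (g0 x) - v (g x)\<bar>" unfolding N_def by auto
    have "shift g v - shift g0 v \<in> QV"
      using QV_diff(1) shift_QV QV0_QV g g0 J(2) vd(1) by blast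
    then have "\<bar>(shift g v - shift g0 v) x\<bar> \<le> qnorm (shift g v - shift g0 v)" by (rule abs_le_qnorm)
    moreover have "(shift g v - shift g0 v) x = v (g x) - v (g0 x)"
      using x KX by (auto simp: shift_def fun_diff_def)
    ultimately have "\<bar>v (g x) - v (g0 x)\<bar> < d" using close[OF vd(1)] by linarith
    then show False using vd(2) by linarith
  qed
  show ?thesis by (rule that[OF J(1,2) main])
qed

lemma openin_sot_ball:
  assumes "v \<in> QV0" "u \<in> QV0"
  shows "openin (sot QV0 qnorm) {f \<in> isometries QV0 qnorm. qnorm (f v - u) < d}"
proof -
  interpret M: Metric_space QV0 "\<lambda>v w. qnorm (v - w)" by (rule Metric_space_QV0)
  have sub: "f v \<in> QV0" if "f \<in> isometries QV0 qnorm" for f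
    using isometries_Bij[OF that] Bij_imp_funcset assms by blast
  have "continuous_map (product_topology (\<lambda>_. M.mtopology) QV0) M.mtopology (\<lambda>f. f v)"
    using continuous_map_product_projection assms by fast
  then have "openin (product_topology (\<lambda>_. M.mtopology) QV0)
      {f \<in> topspace (product_topology (\<lambda>_. M.mtopology) QV0). f v \<in> M.mball u d}"
    using openin_continuous_map_preimage M.openin_mball by blast
  moreover have "{f \<in> isometries QV0 qnorm. qnorm (f v - u) < d} =
      {f \<in> topspace (product_topology (\<lambda>_. M.mtopology) QV0). f v \<in> M.mball u d} \<inter> isometries QV0 qnorm"
    using isometries_Bij Bij_imp_funcset Bij_imp_extensional sub assms M.commute[of u]
    by (fastforce simp: PiE_def)
  ultimately show ?thesis
    unfolding sot_def norm_topology_def openin_subtopology by blast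
qed

lemma topspace_sot_rep: "topspace (subtopology (sot QV0 qnorm) (rep ` G)) = rep ` G"
  using rep_continuous unfolding continuous_map_def by (auto simp: topspace_subtopology)

lemma rep_homeomorphic: "homeomorphic_map T (subtopology (sot QV0 qnorm) (rep ` G)) rep"
proof -
  let ?Z = "subtopology (sot QV0 qnorm) (rep ` G)"
  let ?i = "inv_into G rep"
  have i: "?i (rep g) = g" if "g \<in> G" for g using inv_into_f_f[OF rep_inj that] .
  have "continuous_map ?Z T ?i"
  proof (rule continuous_map_into_T)
    show "?i \<in> topspace ?Z \<rightarrow> G" using i unfolding topspace_sot_rep by auto
    fix K U assume K: "compactin S K" and U: "openin S U"
    show "openin ?Z {z \<in> topspace ?Z. ?i z ` K \<subseteq> U}"
    proof (subst openin_subopen, intro ballI)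
      fix z assume "z \<in> {z \<in> topspace ?Z. ?i z ` K \<subseteq> U}"
      then obtain g0 where g0: "g0 \<in> G" "z = rep g0" "g0 ` K \<subseteq> U" using i unfolding topspace_sot_rep by auto
      show "\<exists>V. openin ?Z V \<and> z \<in> V \<and> V \<subseteq> {z \<in> topspace ?Z. ?i z ` K \<subseteq> U}"
      proof (rule rep_reflects_neighbourhoods[OF g0(1) K U g0(3)])
        fix J assume J: "finite J" "J \<subseteq> QV0 \<times> {0<..}"
          and close: "\<And>g. \<lbrakk>g \<in> G; \<And>v d. (v, d) \<in> J \<Longrightarrow> qnorm (shift g v - shift g0 v) < d\<rbrakk> \<Longrightarrow> g ` K \<subseteq> U"
        \<comment> \<open>The factor \<open>topspace (sot QV0 qnorm)\<close> keeps \<open>W\<close>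
          inside the space when \<open>J\<close> is empty and the intersection over it is
          \<open>UNIV\<close>.\<close>
        define W where "W = topspace (sot QV0 qnorm) \<inter>
          (\<Inter>j\<in>J. {f \<in> isometries QV0 qnorm. qnorm (f (fst j) - shift g0 (fst j)) < snd j})"
        have "openin (sot QV0 qnorm) {f \<in> isometries QV0 qnorm. qnorm (f (fst j) - shift g0 (fst j)) < snd j}"
          if "j \<in> J" for j
          using openin_sot_ball[of "fst j" "shift g0 (fst j)"] J(2) that shift_QV0[OF g0(1)] by auto
        then have "openin (sot QV0 qnorm) W"
          unfolding W_def using J(1) by (cases "J = {}") (auto intro!: openin_Int openin_INT2)
        then have "openin ?Z (W \<inter> rep ` G)" unfolding openin_subtopology by blast
        moreover have "z \<in> W \<inter> rep ` G"
        proof -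
          have "rep g0 (fst j) = shift g0 (fst j)" "0 < snd j" if "j \<in> J" for j
            using J(2) that by (auto simp: rep_def)
          moreover have "z \<in> topspace (sot QV0 qnorm)"
            using rep_continuous g0 unfolding continuous_map_def by auto
          ultimately show ?thesis unfolding W_def using g0 rep_isometry by auto
        qed
        moreover have "W \<inter> rep ` G \<subseteq> {z \<in> topspace ?Z. ?i z ` K \<subseteq> U}"
        proof
          fix f assume f: "f \<in> W \<inter> rep ` G"
          then obtain g where g: "g \<in> G" "f = rep g" by blast
          have "qnorm (shift g v - shift g0 v) < d" if vd: "(v, d) \<in> J" for v d
          proof -
            have "qnorm (f v - shift g0 v) < d" using f vd unfolding W_def by force
            then show ?thesis using g vd J(2) by (auto simp: rep_def)
          qed
          then have "g ` K \<subseteq> U" by (rule close[OF g(1)])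
          then show "f \<in> {z \<in> topspace ?Z. ?i z ` K \<subseteq> U}"
            using g i unfolding topspace_sot_rep by simp
        qed
        ultimately show ?thesis by blast
      qed
    qed
  qed
  moreover have "continuous_map T ?Z rep"
    using rep_continuous by (auto simp: continuous_map_in_subtopology)
  ultimately have "homeomorphic_maps T ?Z rep ?i"
    unfolding homeomorphic_maps_def topspace_sot_rep using i by auto
  then show ?thesis by (rule homeomorphic_maps_imp_map)
qed

text \<open>\<open>rep\<close> reverses products. Inversion reverses them as well and is a
  homeomorphism of the group, so the composite is a homomorphism with the same image.\<close>

lemma representable_group: "rosenthal_representable_group TYPE('a \<Rightarrow> real) Gr T"
proof -
  let ?I = "Is QV0 qnorm"
  define \<phi> where "\<phi> g = rep (inverse_of g)" for g
  have inv_img: "inverse_of ` G = G"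
    using inverse_G inverse_inverse by (metis image_eqI image_subsetI subset_antisym subsetI)
  have img: "\<phi> ` G = rep ` G"
  proof -
    have "\<phi> ` G = rep ` inverse_of ` G" by (auto simp: \<phi>_def)
    then show ?thesis by (simp only: inv_img)
  qed
  have group_I: "group ?I"
    unfolding Is_def using subgroup.subgroup_is_group[OF isometries_subgroup[OF subspace_QV0] group_BijGroup] .
  have "\<phi> \<in> hom Gr ?I"
  proof (rule homI)
    show "\<phi> g \<in> carrier ?I" if "g \<in> carrier Gr" for g
      using that rep_isometry[OF inverse_G] by (simp add: \<phi>_def Is_def)
    fix g h assume gh: "g \<in> carrier Gr" "h \<in> carrier Gr"
    have "inverse_of (g \<otimes>\<^bsub>Gr\<^esub> h) = inverse_of h \<otimes>\<^bsub>Gr\<^esub> inverse_of g"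
      using group.inv_mult_group[OF group_Gr gh] gh Gr_inv
        monoid.m_closed[OF group.is_monoid[OF group_Gr] gh] by simp
    then show "\<phi> (g \<otimes>\<^bsub>Gr\<^esub> h) = \<phi> g \<otimes>\<^bsub>?I\<^esub> \<phi> h"
      using rep_mult inverse_G gh by (simp add: \<phi>_def)
  qed
  then interpret gh: group_hom Gr ?I \<phi>
    using group_Gr group_I by (simp add: group_hom_def group_hom_axioms_def)
  have "inj_on \<phi> G"
  proof (rule inj_onI)
    fix g h assume gh: "g \<in> G" "h \<in> G" "\<phi> g = \<phi> h"
    have "inverse_of g = inverse_of h"
      using inj_onD[OF rep_inj gh(3)[unfolded \<phi>_def] inverse_G inverse_G] gh(1,2) .
    then have "inverse_of (inverse_of g) = inverse_of (inverse_of h)" by (rule arg_cong)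
    then show "g = h" by (simp only: inverse_inverse gh(1,2))
  qed
  then have "\<phi> \<in> iso Gr (?I\<lparr>carrier := rep ` G\<rparr>)"
    using gh.homh img by (auto simp: iso_def hom_def bij_betw_def)
  moreover have "subgroup (rep ` G) ?I" using gh.img_is_subgroup img by simp
  moreover have "homeomorphic_map T (subtopology (sot QV0 qnorm) (rep ` G)) \<phi>"
  proof -
    have "homeomorphic_map T T inverse_of"
      using inv_continuous inverse_inverse by (intro homeomorphic_map_involution) auto
    moreover have "\<phi> = rep \<circ> inverse_of" by (auto simp: \<phi>_def)
    ultimately show ?thesis using homeomorphic_map_compose[OF _ rep_homeomorphic] by simp
  qed
  ultimately show ?thesis
    unfolding rosenthal_representable_group_def
    using topological_group_Gr rosenthal_QV0 by blast
qed

end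

section \<open>Instantiation with compact median pretrees\<close>

lemma (in compact_median_pretree) nested_halfspaces:
  "nested_halfspaces (shadow_topology X R) (halfspaces X R)"
proof
  show "H \<subseteq> topspace (shadow_topology X R)" if "H \<in> halfspaces X R" for H
    using halfspace_subset[OF that] by simp
  show "topspace (shadow_topology X R) - (H \<union> T) = {}"
    if "H \<in> halfspaces X R" "T \<in> halfspaces X R" "a \<in> H \<inter> T" "b \<in> T - H" "c \<in> H - T" for H T a b c
    using halfspaces_nested that by simp
qed (use space_halfspace halfspace_compl compact continuous_monotone_separation in auto)

lemma (in median_pretree) monotone_homeos_subgroup: "subgroup (monotone_homeos X R) (BijGroup X)"
proof -
  interpret B: group "BijGroup X" by (rule group_BijGroup)
  have homeo: "g \<in> homeos (shadow_topology X R)" if "g \<in> monotone_homeos X R" for g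
    using that by (simp add: monotone_homeos_def)
  have bij: "g \<in> Bij X" if "g \<in> monotone_homeos X R" for g
    using homeos_Bij[OF homeo[OF that]] by simp
  have sub: "subgroup (homeos (shadow_topology X R)) (BijGroup X)"
    using homeos_subgroup[of "shadow_topology X R"] by simp
  show ?thesis
  proof
    show "monotone_homeos X R \<subseteq> carrier (BijGroup X)" using bij by (auto simp: BijGroup_def)
    show "f \<otimes>\<^bsub>BijGroup X\<^esub> g \<in> monotone_homeos X R"
      if fg: "f \<in> monotone_homeos X R" "g \<in> monotone_homeos X R" for f g
    proof -
      have "f \<otimes>\<^bsub>BijGroup X\<^esub> g = compose X f g" using fg bij by (simp add: BijGroup_def)
      moreover have "(compose X f g a, compose X f g b, compose X f g c) \<in> R" if "(a, b, c) \<in> R" for a b c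
        using fg that R_in[OF that] by (simp add: monotone_homeos_def compose_def)
      moreover have "f \<otimes>\<^bsub>BijGroup X\<^esub> g \<in> homeos (shadow_topology X R)"
        using subgroup.m_closed[OF sub homeo homeo] fg by blast
      ultimately show ?thesis by (simp add: monotone_homeos_def)
    qed
    show "\<one>\<^bsub>BijGroup X\<^esub> \<in> monotone_homeos X R"
      using subgroup.one_closed[OF sub] R_in by (auto simp: monotone_homeos_def BijGroup_def)
    show "inv\<^bsub>BijGroup X\<^esub> g \<in> monotone_homeos X R" if g: "g \<in> monotone_homeos X R" for g
    proof -
      have gB: "bij_betw g X X" using bij[OF g] by (simp add: Bij_def)
      have inv: "(inv\<^bsub>BijGroup X\<^esub> g) x = inv_into X g x" if "x \<in> X" for x
        using inv_BijGroup[OF bij[OF g]] that by simp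
      have "(inv_into X g a, inv_into X g b, inv_into X g c) \<in> R" if abc: "(a, b, c) \<in> R" for a b c
      proof (rule monotone_imp_reflecting[OF gB])
        show "(g a, g b, g c) \<in> R" if "(a, b, c) \<in> R" for a b c
          using g that by (simp add: monotone_homeos_def)
        have "g (inv_into X g x) = x \<and> inv_into X g x \<in> X" if "x \<in> X" for x
          using that gB by (metis bij_betw_def f_inv_into_f inv_into_into)
        then show "inv_into X g a \<in> X" "inv_into X g b \<in> X" "inv_into X g c \<in> X"
          "(g (inv_into X g a), g (inv_into X g b), g (inv_into X g c)) \<in> R"
          using R_in[OF abc] abc by auto
      qed
      then show ?thesis
        using subgroup.m_inv_closed[OF sub homeo[OF g]] R_in inv by (auto simp: monotone_homeos_def)
    qed
  qed
qed

text \<open>Monotone maps pull convex sets back to convex sets; applied to a halfspace and to its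
  complement this permutes halfspaces.\<close>

lemma (in compact_median_pretree) homeo_action_monotone:
  "homeo_action (shadow_topology X R) (halfspaces X R) (monotone_homeos X R)"
proof (intro homeo_action.intro nested_halfspaces homeo_action_axioms.intro)
  show "subgroup (monotone_homeos X R) (BijGroup (topspace (shadow_topology X R)))"
    using monotone_homeos_subgroup by simp
  show "{x \<in> topspace (shadow_topology X R). g x \<in> H} \<in> halfspaces X R"
    if g: "g \<in> monotone_homeos X R" and H: "H \<in> halfspaces X R" for g H
  proof -
    have mono: "(g a, g b, g c) \<in> R" if "(a, b, c) \<in> R" for a b c
      using g that by (simp add: monotone_homeos_def)
    have conv: "pt_convex X R {x \<in> X. g x \<in> C}" if C: "pt_convex X R C" for C
      unfolding pt_convex_def
    proof (intro conjI ballI subsetI)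
      fix a b x assume ab: "a \<in> {x \<in> X. g x \<in> C}" "b \<in> {x \<in> X. g x \<in> C}" "x \<in> pt_interval X R a b"
      then have "(g a, g x, g b) \<in> R" using mono by (simp add: pt_interval_def)
      then have "g x \<in> pt_interval X R (g a) (g b)" using R_in by (simp add: pt_interval_def)
      then show "x \<in> {x \<in> X. g x \<in> C}" using ab C unfolding pt_convex_def pt_interval_def by blast
    qed auto
    have "g \<in> Bij X" using homeos_Bij[of g "shadow_topology X R"] g by (simp add: monotone_homeos_def)
    then have "X - {x \<in> X. g x \<in> H} = {x \<in> X. g x \<in> X - H}"
      using Bij_imp_funcset by blast
    then show ?thesis using H conv[of H] conv[of "X - H"] unfolding halfspaces_def topspace_shadow_topology
      by (simp only: mem_Collect_eq)
  qed
qed (auto simp: monotone_homeos_def)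

theorem theorem4p7:
  fixes X :: "'a set" and R :: "('a \<times> 'a \<times> 'a) set"
  assumes "compact_median_pretree X R"
  shows "rosenthal_representable_action TYPE('a \<Rightarrow> real)
           (H_plus X R) (H_plus_topology X R) (shadow_topology X R) (\<lambda>g. g) \<and>
         rosenthal_representable_group TYPE('a \<Rightarrow> real) (H_plus X R) (H_plus_topology X R)"
proof -
  interpret homeo_action "shadow_topology X R" "halfspaces X R" "monotone_homeos X R"
    by (rule compact_median_pretree.homeo_action_monotone[OF assms])
  have "Gr = H_plus X R" by (simp add: Gr_def H_plus_def homeo_group_def)
  moreover have "T = H_plus_topology X R" by (simp add: T_def H_plus_topology_def)
  ultimately show ?thesis using representable_action representable_group by simp
qed

end
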